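(* Let $\Gamma\subset\mathrm{Diff}^\delta_+S^1$ be any subgroup containing $\mathrm{SO}(2)$, and let $i:\mathrm{SO}(2)_{\mathrm{tor}}\subset\Gamma$ denote the inclusion. (i) Assume that the homomorphism $$i_*:H_{2k-1}(\mathrm{SO}(2)_{\mathrm{tor}};\mathbb{Z})\cong\mathbb{Q}/\mathbb{Z}\longrightarrow H_{2k-1}(\Gamma;\mathbb{Z})$$ is injective (resp. non-trivial) for some $k$. Then the homomorphisms $$i_*:H_{2l-1}(\mathrm{SO}(2)_{\mathrm{tor}};\mathbb{Z})\cong\mathbb{Q}/\mathbb{Z}\longrightarrow H_{2l-1}(\Gamma;\mathbb{Z})$$ are injective (resp. non-trivial) for all $l\ge k$. (ii) Assume that $\chi^k=0\in H^{2k}(\Gamma;\mathbb{Q})$. Then the homomorphisms $$i_*:H_{2l-1}(\mathrm{SO}(2)_{\mathrm{tor}};\mathbb{Z})\cong\mathbb{Q}/\mathbb{Z}\longrightarrow H_{2l-1}(\Gamma;\mathbb{Z})$$ are injective for all $l\ge k$.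
   Context: $\mathrm{Diff}^\delta_+S^1$ is the group of orientation preserving $C^\infty$ diffeomorphisms of $S^1=\mathbb{R}/\mathbb{Z}$, with the discrete topology. $\mathrm{SO}(2)\subset\mathrm{Diff}_+S^1$ is the subgroup of rotations and $\mathrm{SO}(2)_{\mathrm{tor}}\cong\mathbb{Q}/\mathbb{Z}$ its torsion subgroup (rational rotations). All groups are discrete and $H_*(\Gamma)$, $H^*(\Gamma)$ denote group (co)homology with trivial coefficients. $k,l$ are positive integers. $\chi\in H^2(\Gamma;\mathbb{Q})$ is the restriction to $\Gamma$ of the rational Euler class of flat $S^1$-bundles, i.e. of the rational class of the central extension $0\to\mathbb{Z}\to\{f\in\mathrm{Diff}^\infty_+\mathbb{R}: fT=Tf\}\to\mathrm{Diff}_+S^1\to1$, where $T(x)=x+1$ generates the kernel. *)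

theory Defs
  imports "HOL-Analysis.Analysis" "HOL-Algebra.Algebra"
begin

section \<open>Homology of a discrete group with integer coefficients\<close>

text \<open>
  We use the (inhomogeneous) bar complex. A list \<open>[g\<^sub>1, \<dots>, g\<^sub>n]\<close> of elements of the group stands
  for the bar generator \<open>[g\<^sub>1|\<dots>|g\<^sub>n]\<close>, and chains are elements of free abelian groups on such
  lists.
\<close>

definition tuples :: "nat \<Rightarrow> ('g, 'b) monoid_scheme \<Rightarrow> 'g list set" where
  "tuples n G = {xs. length xs = n \<and> set xs \<subseteq> carrier G}"

definition bar_face :: "('g, 'b) monoid_scheme \<Rightarrow> nat \<Rightarrow> 'g list \<Rightarrow> 'g list" where
  "bar_face G i xs =
     (if i = 0 then tl xs
      else if i = length xs then butlast xs
      else take (i - 1) xs @ [xs ! (i - 1) \<otimes>\<^bsub>G\<^esub> xs ! i] @ drop (i + 1) xs)"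

definition bar_chains :: "nat \<Rightarrow> ('g, 'b) monoid_scheme \<Rightarrow> ('g list \<Rightarrow>\<^sub>0 int) monoid" where
  "bar_chains n G = free_Abelian_group (tuples n G)"

definition bar_boundary :: "('g, 'b) monoid_scheme \<Rightarrow> ('g list \<Rightarrow>\<^sub>0 int) \<Rightarrow> ('g list \<Rightarrow>\<^sub>0 int)" where
  "bar_boundary G =
     frag_extend (\<lambda>xs. if xs = [] then 0
       else (\<Sum>i\<le>length xs. frag_cmul ((- 1) ^ i) (frag_of (bar_face G i xs))))"

definition bar_cycles :: "nat \<Rightarrow> ('g, 'b) monoid_scheme \<Rightarrow> ('g list \<Rightarrow>\<^sub>0 int) set" where
  "bar_cycles n G = {c \<in> carrier (bar_chains n G). bar_boundary G c = 0}"

definition bar_boundaries :: "nat \<Rightarrow> ('g, 'b) monoid_scheme \<Rightarrow> ('g list \<Rightarrow>\<^sub>0 int) set" where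
  "bar_boundaries n G = bar_boundary G ` carrier (bar_chains (Suc n) G)"

definition group_homology ::
    "nat \<Rightarrow> ('g, 'b) monoid_scheme \<Rightarrow> ('g list \<Rightarrow>\<^sub>0 int) set monoid" where
  "group_homology n G =
     ((bar_chains n G)\<lparr>carrier := bar_cycles n G\<rparr>) Mod bar_boundaries n G"

text \<open>
  The map induced by a homomorphism \<open>\<phi>\<close> into \<open>H\<close>. As for the operations on a quotient group in the
  library, it is the union of the (coinciding) cosets obtained from all representatives.
\<close>

definition homology_map ::
    "nat \<Rightarrow> ('h, 'c) monoid_scheme \<Rightarrow> ('g \<Rightarrow> 'h) \<Rightarrow> ('g list \<Rightarrow>\<^sub>0 int) set \<Rightarrow> ('h list \<Rightarrow>\<^sub>0 int) set" where
  "homology_map n H \<phi> A =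
     (\<Union>c\<in>A. bar_boundaries n H #>\<^bsub>bar_chains n H\<^esub> frag_extend (\<lambda>xs. frag_of (map \<phi> xs)) c)"


section \<open>Cohomology of a discrete group with coefficients in a commutative ring\<close>

text \<open>Cochains are functions on bar generators, extended by zero to all other lists.\<close>

definition bar_cochains ::
    "nat \<Rightarrow> ('g, 'b) monoid_scheme \<Rightarrow> ('g list \<Rightarrow> 'r::comm_ring_1) monoid" where
  "bar_cochains n G =
     \<lparr>carrier = {f. \<forall>xs. xs \<notin> tuples n G \<longrightarrow> f xs = 0},
      mult = (\<lambda>f g xs. f xs + g xs), one = (\<lambda>_. 0)\<rparr>"

definition bar_coboundary ::
    "nat \<Rightarrow> ('g, 'b) monoid_scheme \<Rightarrow> ('g list \<Rightarrow> 'r::comm_ring_1) \<Rightarrow> 'g list \<Rightarrow> 'r" where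
  "bar_coboundary n G f =
     (\<lambda>xs. if xs \<in> tuples (Suc n) G then (\<Sum>i\<le>Suc n. (- 1) ^ i * f (bar_face G i xs)) else 0)"

definition bar_cocycles ::
    "nat \<Rightarrow> ('g, 'b) monoid_scheme \<Rightarrow> ('g list \<Rightarrow> 'r::comm_ring_1) set" where
  "bar_cocycles n G = {f \<in> carrier (bar_cochains n G). bar_coboundary n G f = (\<lambda>_. 0)}"

definition bar_coboundaries ::
    "nat \<Rightarrow> ('g, 'b) monoid_scheme \<Rightarrow> ('g list \<Rightarrow> 'r::comm_ring_1) set" where
  "bar_coboundaries n G =
     (case n of 0 \<Rightarrow> {\<lambda>_. 0} | Suc m \<Rightarrow> bar_coboundary m G ` carrier (bar_cochains m G))"

definition group_cohomology ::
    "nat \<Rightarrow> ('g, 'b) monoid_scheme \<Rightarrow> ('g list \<Rightarrow> 'r::comm_ring_1) set monoid" where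
  "group_cohomology n G =
     ((bar_cochains n G)\<lparr>carrier := bar_cocycles n G\<rparr>) Mod bar_coboundaries n G"

definition cohomology_class ::
    "nat \<Rightarrow> ('g, 'b) monoid_scheme \<Rightarrow> ('g list \<Rightarrow> 'r::comm_ring_1) \<Rightarrow> ('g list \<Rightarrow> 'r) set" where
  "cohomology_class n G f = bar_coboundaries n G #>\<^bsub>bar_cochains n G\<^esub> f"

text \<open>The map induced by a homomorphism \<open>\<phi>\<close> defined on \<open>G\<close>.\<close>

definition cohomology_map ::
    "nat \<Rightarrow> ('g, 'b) monoid_scheme \<Rightarrow> ('g \<Rightarrow> 'h) \<Rightarrow> ('h list \<Rightarrow> 'r::comm_ring_1) set
      \<Rightarrow> ('g list \<Rightarrow> 'r) set" where
  "cohomology_map n G \<phi> A =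
     (\<Union>f\<in>A. cohomology_class n G (\<lambda>xs. if xs \<in> tuples n G then f (map \<phi> xs) else 0))"

definition cup_cochain ::
    "nat \<Rightarrow> ('g list \<Rightarrow> 'r::comm_ring_1) \<Rightarrow> ('g list \<Rightarrow> 'r) \<Rightarrow> 'g list \<Rightarrow> 'r" where
  "cup_cochain p f g = (\<lambda>xs. f (take p xs) * g (drop p xs))"

text \<open>The cup product of a class \<open>A\<close> of degree \<open>p\<close> and a class \<open>B\<close> of degree \<open>q\<close>.\<close>

definition cup ::
    "('g, 'b) monoid_scheme \<Rightarrow> nat \<Rightarrow> nat \<Rightarrow> ('g list \<Rightarrow> 'r::comm_ring_1) set \<Rightarrow> ('g list \<Rightarrow> 'r) set
      \<Rightarrow> ('g list \<Rightarrow> 'r) set" where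
  "cup G p q A B = (\<Union>f\<in>A. \<Union>g\<in>B. cohomology_class (p + q) G (cup_cochain p f g))"

text \<open>The \<open>k\<close>-th power, in degree \<open>p * k\<close>, of a class \<open>A\<close> of degree \<open>p\<close>.\<close>

primrec cup_power ::
    "('g, 'b) monoid_scheme \<Rightarrow> nat \<Rightarrow> ('g list \<Rightarrow> 'r::comm_ring_1) set \<Rightarrow> nat
      \<Rightarrow> ('g list \<Rightarrow> 'r) set" where
  "cup_power G p A 0 = cohomology_class 0 G (\<lambda>xs. if xs = [] then 1 else 0)"
| "cup_power G p A (Suc k) = cup G (p * k) p (cup_power G p A k) A"


section \<open>The class of a central extension by the integers\<close>

text \<open>
  For a central extension \<open>0 \<rightarrow> \<int> \<rightarrow> E \<rightarrow> G \<rightarrow> 1\<close> with inclusion \<open>j\<close> and projection \<open>p\<close>, a set-theoretic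
  section \<open>s\<close> gives the 2-cocycle \<open>c\<close> with \<open>s(g) s(h) = j(c(g,h)) s(gh)\<close>. Its class does not
  depend on \<open>s\<close>.
\<close>

definition is_section ::
    "('e, 'b) monoid_scheme \<Rightarrow> ('e \<Rightarrow> 'g) \<Rightarrow> ('g, 'c) monoid_scheme \<Rightarrow> ('g \<Rightarrow> 'e) \<Rightarrow> bool" where
  "is_section E p G s \<longleftrightarrow> (\<forall>g\<in>carrier G. s g \<in> carrier E \<and> p (s g) = g)"

definition extension_cocycle ::
    "('e, 'b) monoid_scheme \<Rightarrow> (int \<Rightarrow> 'e) \<Rightarrow> ('g, 'c) monoid_scheme \<Rightarrow> ('g \<Rightarrow> 'e) \<Rightarrow> 'g list \<Rightarrow> int" where
  "extension_cocycle E j G s =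
     (\<lambda>xs. if xs \<in> tuples 2 G
       then THE n. s (xs ! 0) \<otimes>\<^bsub>E\<^esub> s (xs ! 1) = j n \<otimes>\<^bsub>E\<^esub> s (xs ! 0 \<otimes>\<^bsub>G\<^esub> xs ! 1)
       else 0)"

definition rational_extension_class ::
    "('e, 'b) monoid_scheme \<Rightarrow> (int \<Rightarrow> 'e) \<Rightarrow> ('e \<Rightarrow> 'g) \<Rightarrow> ('g, 'c) monoid_scheme
      \<Rightarrow> ('g list \<Rightarrow> rat) set" where
  "rational_extension_class E j p G =
     cohomology_class 2 G
       (\<lambda>xs. of_int (extension_cocycle E j G (SOME s. is_section E p G s) xs))"


section \<open>Diffeomorphisms of the circle and of the line\<close>

quotient_type circle = real / "\<lambda>x y. x - y \<in> \<int>"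
  morphisms rep_circle circle_of
proof (rule equivpI)
  show "reflp (\<lambda>x y::real. x - y \<in> \<int>)"
    by (simp add: reflp_def)
  show "symp (\<lambda>x y::real. x - y \<in> \<int>)"
  proof (rule sympI)
    fix x y :: real
    assume "x - y \<in> \<int>"
    then have "- (x - y) \<in> \<int>"
      by (rule Ints_minus)
    then show "y - x \<in> \<int>"
      by simp
  qed
  show "transp (\<lambda>x y::real. x - y \<in> \<int>)"
  proof (rule transpI)
    fix x y z :: real
    assume "x - y \<in> \<int>" "y - z \<in> \<int>"
    then have "(x - y) + (y - z) \<in> \<int>"
      by (rule Ints_add)
    then show "x - z \<in> \<int>"
      by simp
  qed
qed

text \<open>To be used for open \<open>U\<close> only.\<close>

definition smooth_on :: "real set \<Rightarrow> (real \<Rightarrow> real) \<Rightarrow> bool" where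
  "smooth_on U F \<longleftrightarrow> (\<forall>n. \<forall>x\<in>U. (deriv ^^ n) F differentiable (at x))"

text \<open>
  The charts of the circle are the local inverses of the projection \<^term>\<open>circle_of\<close>, so a smooth
  local lift is a representation of \<open>f\<close> in charts. Continuity of \<open>f\<close> is implied by the existence of
  such lifts.
\<close>

definition smooth_local_lift :: "(circle \<Rightarrow> circle) \<Rightarrow> real set \<Rightarrow> (real \<Rightarrow> real) \<Rightarrow> bool" where
  "smooth_local_lift f U F \<longleftrightarrow>
     open U \<and> smooth_on U F \<and> (\<forall>y\<in>U. f (circle_of y) = circle_of (F y))"

definition circle_smooth :: "(circle \<Rightarrow> circle) \<Rightarrow> bool" where
  "circle_smooth f \<longleftrightarrow> (\<forall>x. \<exists>U F. x \<in> U \<and> smooth_local_lift f U F)"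

definition circle_orientation_preserving :: "(circle \<Rightarrow> circle) \<Rightarrow> bool" where
  "circle_orientation_preserving f \<longleftrightarrow>
     (\<forall>U F x. smooth_local_lift f U F \<longrightarrow> x \<in> U \<longrightarrow> deriv F x > 0)"

definition Diff_circle :: "(circle \<Rightarrow> circle) monoid" where
  "Diff_circle =
     \<lparr>carrier = {f. bij f \<and> circle_smooth f \<and> circle_smooth (inv_into UNIV f) \<and>
                    circle_orientation_preserving f},
      mult = (\<circ>), one = id\<rparr>"

lift_definition rotation :: "real \<Rightarrow> circle \<Rightarrow> circle" is "\<lambda>a x. x + a"
  by simp

definition SO2 :: "(circle \<Rightarrow> circle) set" where
  "SO2 = range rotation"

definition SO2_tor :: "(circle \<Rightarrow> circle) set" where
  "SO2_tor = {r \<in> SO2. \<exists>n::nat. n > 0 \<and> r [^]\<^bsub>Diff_circle\<^esub> n = \<one>\<^bsub>Diff_circle\<^esub>}"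

definition Diff_line :: "(real \<Rightarrow> real) set" where
  "Diff_line = {F. bij F \<and> smooth_on UNIV F \<and> smooth_on UNIV (inv_into UNIV F) \<and>
                   (\<forall>x. deriv F x > 0)}"

text \<open>The inclusion of the kernel \<open>\<int>\<close>: it sends \<open>1\<close> to \<open>T(x) = x + 1\<close>.\<close>

definition translation :: "int \<Rightarrow> real \<Rightarrow> real" where
  "translation n = (\<lambda>x. x + of_int n)"

definition Diff_line_periodic :: "(real \<Rightarrow> real) monoid" where
  "Diff_line_periodic =
     \<lparr>carrier = {F \<in> Diff_line. F \<circ> translation 1 = translation 1 \<circ> F},
      mult = (\<circ>), one = id\<rparr>"

definition descend :: "(real \<Rightarrow> real) \<Rightarrow> circle \<Rightarrow> circle" where
  "descend F = (THE f. \<forall>x. f (circle_of x) = circle_of (F x))"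

definition euler_class :: "((circle \<Rightarrow> circle) list \<Rightarrow> rat) set" where
  "euler_class = rational_extension_class Diff_line_periodic translation descend Diff_circle"

definition euler_class_on ::
    "(circle \<Rightarrow> circle) set \<Rightarrow> ((circle \<Rightarrow> circle) list \<Rightarrow> rat) set" where
  "euler_class_on \<Gamma> = cohomology_map 2 (Diff_circle\<lparr>carrier := \<Gamma>\<rparr>) id euler_class"


section \<open>The group of rationals modulo the integers\<close>

definition rat_mod_int :: "rat set monoid" where
  "rat_mod_int = \<lparr>carrier = (UNIV :: rat set), mult = (+), one = 0\<rparr> Mod \<int>"


section \<open>The map in homology induced by the inclusion of the rational rotations\<close>

abbreviation H_sub ::
    "(circle \<Rightarrow> circle) set \<Rightarrow> nat \<Rightarrow> ((circle \<Rightarrow> circle) list \<Rightarrow>\<^sub>0 int) set monoid" where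
  "H_sub \<Gamma> n \<equiv> group_homology n (Diff_circle\<lparr>carrier := \<Gamma>\<rparr>)"

abbreviation incl_homology ::
    "(circle \<Rightarrow> circle) set \<Rightarrow> nat \<Rightarrow> ((circle \<Rightarrow> circle) list \<Rightarrow>\<^sub>0 int) set
      \<Rightarrow> ((circle \<Rightarrow> circle) list \<Rightarrow>\<^sub>0 int) set" where
  "incl_homology \<Gamma> n \<equiv> homology_map n (Diff_circle\<lparr>carrier := \<Gamma>\<rparr>) id"

definition incl_injective :: "(circle \<Rightarrow> circle) set \<Rightarrow> nat \<Rightarrow> bool" where
  "incl_injective \<Gamma> n \<longleftrightarrow> inj_on (incl_homology \<Gamma> n) (carrier (H_sub SO2_tor n))"

definition incl_nontrivial :: "(circle \<Rightarrow> circle) set \<Rightarrow> nat \<Rightarrow> bool" where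
  "incl_nontrivial \<Gamma> n \<longleftrightarrow> (\<exists>a\<in>carrier (H_sub SO2_tor n). incl_homology \<Gamma> n a \<noteq> \<one>\<^bsub>H_sub \<Gamma> n\<^esub>)"

end

(*
  For C = SO(2)_tor = Q/Z, the cap product with the Euler cocycle maps H_(m+2)(C) isomorphically to
  H_m(C) for m >= 1. On the finite cyclic subgroups this is the periodicity of their homology, and an
  explicit contraction of the bar complex shows it at chain level. Since H_1(C) = Q/Z through the
  rotation number, iterating the cap product identifies H_(2l-1)(C) with Q/Z.

  The cap product is natural in the group, so injectivity and non-triviality of i_* propagate from
  degree 2k-1 to degree 2k+1. If the k-th power of the Euler cocycle is the coboundary of a rational
  cochain b on Gamma, then b takes integral values on boundaries of integral chains of Gamma, while on
  a cycle z of C it takes the rational value that represents the class of z in Q/Z; hence i_* is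
  injective in degree 2k-1.

  Only products and the unit of Gamma matter for the bar complex, so the groups are treated as monoids.
*)

theory Submission
  imports Defs
begin

section \<open>The bar complex\<close>

text \<open>The lever is that the Euler cocycle c is integral on \<Gamma> but acquires a rational
  primitive on the rational rotations: there c = \<delta>\<sigma> with \<sigma> the rotation number,
  so c^(j+1) = \<delta>(c^j \<sigma>). The cochain c^j \<sigma> takes integral values on boundaries,
  and its values modulo the integers are the invariant in degree 2j+1. Any other rational primitive
  must agree with it on cycles, since the homology in question is torsion.

  Three obstacles shape the computation. The lifts behind the Euler class are an arbitrary choice,
  so c has no known values even on roots of unity; it is first replaced by the cohomologous cocycle
  of carries in addition modulo n. The bar complex is not normalized, so lists containing the unit
  do not vanish and need correction terms. And Q/Z has no generator, so the formulas are applied in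
  a finite cyclic subgroup large enough for the chains at hand; only the cap product, which does not
  refer to n, survives the passage to the union.\<close>

definition prepend :: "'a \<Rightarrow> ('a list \<Rightarrow>\<^sub>0 int) \<Rightarrow> ('a list \<Rightarrow>\<^sub>0 int)" where
  "prepend g = frag_extend (\<lambda>xs. frag_of (g # xs))"

lemma prepend_frag_of [simp]: "prepend g (frag_of xs) = frag_of (g # xs)"
  by (simp add: prepend_def)

lemma prepend_zero [simp]: "prepend g 0 = 0"
  by (simp add: prepend_def)

lemma prepend_add: "prepend g (x + y) = prepend g x + prepend g y"
  by (simp add: prepend_def frag_extend_add)

lemma prepend_diff: "prepend g (x - y) = prepend g x - prepend g y"
  by (simp add: prepend_def frag_extend_diff)

lemma prepend_minus: "prepend g (- x) = - prepend g x"
  by (simp add: prepend_def frag_extend_minus)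

lemma prepend_cmul: "prepend g (frag_cmul a x) = frag_cmul a (prepend g x)"
  by (simp add: prepend_def frag_extend_cmul)

lemma prepend_sum: "prepend g (sum f I) = (\<Sum>i\<in>I. prepend g (f i))"
  by (induction I rule: infinite_finite_induct) (simp_all add: prepend_add)

lemmas prepend_linear = prepend_add prepend_diff prepend_minus prepend_cmul prepend_sum

lemma bar_boundary_zero [simp]: "bar_boundary G 0 = 0"
  by (simp add: bar_boundary_def)

lemma bar_boundary_add: "bar_boundary G (x + y) = bar_boundary G x + bar_boundary G y"
  by (simp add: bar_boundary_def frag_extend_add)

lemma bar_boundary_diff: "bar_boundary G (x - y) = bar_boundary G x - bar_boundary G y"
  by (simp add: bar_boundary_def frag_extend_diff)

lemma bar_boundary_minus: "bar_boundary G (- x) = - bar_boundary G x"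
  by (simp add: bar_boundary_def frag_extend_minus)

lemma bar_boundary_cmul: "bar_boundary G (frag_cmul a x) = frag_cmul a (bar_boundary G x)"
  by (simp add: bar_boundary_def frag_extend_cmul)

lemma bar_boundary_sum: "bar_boundary G (sum f I) = (\<Sum>i\<in>I. bar_boundary G (f i))"
  by (induction I rule: infinite_finite_induct) (simp_all add: bar_boundary_add)

lemmas bar_boundary_linear = bar_boundary_add bar_boundary_diff bar_boundary_minus
  bar_boundary_cmul bar_boundary_sum

lemma bar_boundary_Nil [simp]: "bar_boundary G (frag_of []) = 0"
  by (simp add: bar_boundary_def)

lemma bar_boundary_singleton [simp]: "bar_boundary G (frag_of [g]) = 0"
  by (simp add: bar_boundary_def bar_face_def)

lemma bar_face_Suc_Cons:
  assumes "0 < i" "i \<le> length xs"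
  shows "bar_face G (Suc i) (g # xs) = g # bar_face G i xs"
proof -
  obtain j where "i = Suc j" using assms(1) by (cases i) auto
  then show ?thesis using assms by (auto simp: bar_face_def)
qed

text \<open>Every face of index at least 2 keeps \<open>g\<close> in front of a face of
  \<open>h # xs\<close> of positive index, with the opposite sign; subtracting \<open>xs\<close>
  removes the face of index 0. This recursion replaces the alternating sum in most computations
  below.\<close>

lemma bar_boundary_Cons_Cons:
  "bar_boundary G (frag_of (g # h # xs)) =
     frag_of (h # xs) - frag_of ((g \<otimes>\<^bsub>G\<^esub> h) # xs)
     - prepend g (bar_boundary G (frag_of (h # xs)) - frag_of xs)"
proof -
  define m where "m = length xs"
  define S where "S = (\<Sum>i\<le>m. frag_cmul ((-1) ^ Suc i) (frag_of (bar_face G (Suc i) (h # xs))))"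
  have 1: "bar_boundary G (frag_of (h # xs)) = frag_of xs + S"
    by (simp add: bar_boundary_def sum.atMost_Suc_shift S_def m_def bar_face_def del: sum.atMost_Suc)
  have "bar_boundary G (frag_of (g # h # xs)) = frag_of (h # xs) - frag_of ((g \<otimes>\<^bsub>G\<^esub> h) # xs)
      + (\<Sum>i\<le>m. frag_cmul ((-1) ^ i) (frag_of (bar_face G (Suc (Suc i)) (g # h # xs))))"
    by (simp add: bar_boundary_def sum.atMost_Suc_shift m_def del: sum.atMost_Suc)
       (simp add: bar_face_def)
  also have "(\<Sum>i\<le>m. frag_cmul ((-1) ^ i) (frag_of (bar_face G (Suc (Suc i)) (g # h # xs))))
      = - prepend g S"
    unfolding S_def prepend_linear prepend_frag_of sum_negf[symmetric]
    by (rule sum.cong) (auto simp: bar_face_Suc_Cons m_def prepend_cmul)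
  finally show ?thesis by (simp add: 1)
qed

lemma tuples_0 [simp]: "tuples 0 G = {[]}"
  by (auto simp: tuples_def)

lemma tuples_Suc: "tuples (Suc n) G = {g # xs |g xs. g \<in> carrier G \<and> xs \<in> tuples n G}"
  by (auto simp: tuples_def length_Suc_conv)

lemma Cons_in_tuples [simp]: "g # xs \<in> tuples (Suc n) G \<longleftrightarrow> g \<in> carrier G \<and> xs \<in> tuples n G"
  by (auto simp: tuples_Suc)

lemma chains_diff:
  "Poly_Mapping.keys (x :: 'a \<Rightarrow>\<^sub>0 int) \<subseteq> S \<Longrightarrow> Poly_Mapping.keys y \<subseteq> S \<Longrightarrow> Poly_Mapping.keys (x - y) \<subseteq> S"
  using keys_diff[of x y] by blast

lemma chains_add:
  "Poly_Mapping.keys (x :: 'a \<Rightarrow>\<^sub>0 int) \<subseteq> S \<Longrightarrow> Poly_Mapping.keys y \<subseteq> S \<Longrightarrow> Poly_Mapping.keys (x + y) \<subseteq> S"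
  using keys_add[of x y] by blast

lemma chains_sum:
  "(\<And>i. i \<in> I \<Longrightarrow> Poly_Mapping.keys (f i :: 'a \<Rightarrow>\<^sub>0 int) \<subseteq> S) \<Longrightarrow> Poly_Mapping.keys (sum f I) \<subseteq> S"
  using keys_sum[of f I] by blast

lemma prepend_chain:
  assumes "Poly_Mapping.keys x \<subseteq> tuples n G" "g \<in> carrier G"
  shows "Poly_Mapping.keys (prepend g x) \<subseteq> tuples (Suc n) G"
  using assms(1) by (induction x rule: frag_induction) (auto simp: prepend_diff assms chains_diff)

context monoid begin

lemma bar_boundary_chain:
  assumes "Poly_Mapping.keys x \<subseteq> tuples (Suc n) G"
  shows "Poly_Mapping.keys (bar_boundary G x) \<subseteq> tuples n G"
proof -
  have *: "xs \<in> tuples (Suc n) G \<Longrightarrow> Poly_Mapping.keys (bar_boundary G (frag_of xs)) \<subseteq> tuples n G" for xs n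
  proof (induction n arbitrary: xs)
    case 0
    then show ?case by (auto simp: tuples_Suc)
  next
    case (Suc n)
    then obtain g h ys where xs: "xs = g # h # ys" and mem: "g \<in> carrier G" "h \<in> carrier G" "ys \<in> tuples n G"
      by (auto simp: tuples_Suc)
    have "Poly_Mapping.keys (bar_boundary G (frag_of (h # ys)) - frag_of ys) \<subseteq> tuples n G"
      by (rule chains_diff) (use mem Suc.IH[of "h # ys"] in auto)
    then have "Poly_Mapping.keys (prepend g (bar_boundary G (frag_of (h # ys)) - frag_of ys)) \<subseteq> tuples (Suc n) G"
      using mem by (rule_tac prepend_chain)
    then show ?case
      unfolding xs bar_boundary_Cons_Cons
      by (intro chains_diff) (use mem in auto)
  qed
  show ?thesis
    using assms by (induction x rule: frag_induction) (auto simp: bar_boundary_diff chains_diff *)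
qed

lemma bar_boundary_bar_boundary:
  assumes "Poly_Mapping.keys x \<subseteq> tuples n G"
  shows "bar_boundary G (bar_boundary G x) = 0"
proof -
  \<comment> \<open>\<open>L g\<close> multiplies the first entry by \<open>g\<close> from the left
    and \<open>T\<close> deletes it. In these terms the recursion for the boundary extends from
    lists to chains, see \<open>bd_prepend\<close>.\<close>
  define L where "L g = frag_extend (\<lambda>xs. case xs of [] \<Rightarrow> 0 | h # ys \<Rightarrow> frag_of ((g \<otimes> h) # ys))" for g
  define T where "T = frag_extend (\<lambda>xs :: 'a list. case xs of [] \<Rightarrow> 0 | h # ys \<Rightarrow> frag_of ys)"
  have L_diff: "L g (x - y) = L g x - L g y" and T_diff: "T (x - y) = T x - T y" for g x y
    by (simp_all add: L_def T_def frag_extend_diff)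
  have L_of [simp]: "L g (frag_of (h # ys)) = frag_of ((g \<otimes> h) # ys)"
    and T_of [simp]: "T (frag_of (h # ys)) = frag_of ys"
    and L0 [simp]: "L g 0 = 0" and T0 [simp]: "T 0 = 0" for g h ys
    by (simp_all add: L_def T_def)
  have L_prepend: "L g (prepend h x) = prepend (g \<otimes> h) x" for g h x
    using subset_UNIV by (induction x rule: frag_induction) (auto simp: L_diff prepend_diff)
  have T_prepend: "T (prepend h x) = x" for h x
    using subset_UNIV by (induction x rule: frag_induction) (auto simp: T_diff prepend_diff)
  have bd_prepend: "bar_boundary G (prepend g x) = x - L g x - prepend g (bar_boundary G x - T x)"
    if "Poly_Mapping.keys x \<subseteq> tuples (Suc m) G" for g m x
    using that
  proof (induction x rule: frag_induction)
    case (one xs)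
    then show ?case by (auto simp: tuples_Suc bar_boundary_Cons_Cons)
  qed (auto simp: L_diff T_diff prepend_diff bar_boundary_diff)
  have *: "xs \<in> tuples n G \<Longrightarrow> bar_boundary G (bar_boundary G (frag_of xs)) = 0" for xs n
  proof (induction n arbitrary: xs)
    case 0
    then show ?case by simp
  next
    case (Suc n)
    consider g where "xs = [g]" | g h where "xs = [g, h]"
      | g h k ys where "xs = g # h # k # ys"
      using Suc.prems by (cases xs rule: remdups_adj.cases; cases "tl (tl xs)") (auto simp: tuples_def)
    then show ?case
    proof cases
      case 1
      then show ?thesis by simp
    next
      case 2
      then show ?thesis by (simp add: bar_boundary_Cons_Cons bar_boundary_linear prepend_linear)
    next
      case 3
      with Suc.prems obtain m where n: "n = Suc (Suc m)" by (auto simp: tuples_def)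
      have mem: "g \<in> carrier G" "h \<in> carrier G" "k \<in> carrier G" "ys \<in> tuples m G"
        using Suc.prems 3 n by auto
      \<comment> \<open>The boundary of the tail without its face of index 0. By associativity, left
        multiplication of the first entry by \<open>g\<close> commutes with the remaining faces;
        this is what \<open>gh\<close> records.\<close>
      define y where "y = bar_boundary G (frag_of (h # k # ys)) - frag_of (k # ys)"
      have y: "y = - frag_of ((h \<otimes> k) # ys) - prepend h (bar_boundary G (frag_of (k # ys)) - frag_of ys)"
        by (simp add: y_def bar_boundary_Cons_Cons[of G h k])
      have "bar_boundary G (frag_of (h # k # ys)) = frag_of (k # ys) + y"
        by (simp add: y_def)
      have yk: "Poly_Mapping.keys y \<subseteq> tuples (Suc m) G"
        unfolding y_def by (intro chains_diff bar_boundary_chain) (use mem in auto)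
      have "bar_boundary G (bar_boundary G (frag_of (h # k # ys))) = 0"
        using Suc.IH[of "h # k # ys"] mem n by simp
      then have bdy: "bar_boundary G y = - bar_boundary G (frag_of (k # ys))"
        by (simp add: y_def bar_boundary_diff)
      have Ty: "T y = - bar_boundary G (frag_of (k # ys))"
        by (simp add: y T_diff T_prepend flip: diff_0)
      have Ly: "L g y = - frag_of ((g \<otimes> (h \<otimes> k)) # ys)
          - prepend (g \<otimes> h) (bar_boundary G (frag_of (k # ys)) - frag_of ys)"
        by (simp add: y L_diff L_prepend flip: diff_0)
      have gh: "bar_boundary G (frag_of ((g \<otimes> h) # k # ys)) = frag_of (k # ys) + L g y"
        by (simp add: Ly bar_boundary_Cons_Cons[of G "g \<otimes> h"] m_assoc mem)
      have "bar_boundary G (frag_of xs) = frag_of (h # k # ys) - frag_of ((g \<otimes> h) # k # ys) - prepend g y"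
        by (simp add: 3 y_def bar_boundary_Cons_Cons[of G g])
      then have "bar_boundary G (bar_boundary G (frag_of xs))
          = bar_boundary G (frag_of (h # k # ys)) - (frag_of (k # ys) + L g y) - (y - L g y)"
        by (simp add: bar_boundary_diff gh bd_prepend[OF yk] bdy Ty)
      then show ?thesis by (simp add: y_def)
    qed
  qed
  show ?thesis
    using assms by (induction x rule: frag_induction) (auto simp: bar_boundary_diff *)
qed

end


section \<open>Cap product with a 2-cocycle\<close>

text \<open>The cocycle consumes entries at the front, the end at which the boundary recursion works
  and at which \<open>prepend\<close> can undo the operation. Since its degree is even, no sign
  enters.\<close>

definition cap :: "('a \<Rightarrow> 'a \<Rightarrow> int) \<Rightarrow> ('a list \<Rightarrow>\<^sub>0 int) \<Rightarrow> ('a list \<Rightarrow>\<^sub>0 int)" where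
  "cap c = frag_extend (\<lambda>xs. case xs of g # h # ys \<Rightarrow> frag_cmul (c g h) (frag_of ys) | _ \<Rightarrow> 0)"

lemma cap_frag_of [simp]: "cap c (frag_of (g # h # xs)) = frag_cmul (c g h) (frag_of xs)"
  by (simp add: cap_def)

lemma cap_short [simp]: "cap c 0 = 0" "cap c (frag_of []) = 0" "cap c (frag_of [g]) = 0"
  by (simp_all add: cap_def)

lemma cap_add: "cap c (x + y) = cap c x + cap c y"
  by (simp add: cap_def frag_extend_add)

lemma cap_diff: "cap c (x - y) = cap c x - cap c y"
  by (simp add: cap_def frag_extend_diff)

lemma cap_minus: "cap c (- x) = - cap c x"
  by (simp add: cap_def frag_extend_minus)

lemma cap_cmul: "cap c (frag_cmul a x) = frag_cmul a (cap c x)"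
  by (simp add: cap_def frag_extend_cmul)

lemma cap_sum: "cap c (sum f I) = (\<Sum>i\<in>I. cap c (f i))"
  by (induction I rule: infinite_finite_induct) (simp_all add: cap_add)

lemmas cap_linear = cap_add cap_diff cap_minus cap_cmul cap_sum

lemma frag_cmul_diff_distrib2: "frag_cmul a (x - y) = frag_cmul a x - frag_cmul a y"
  by (rule poly_mapping_eqI) (simp add: lookup_minus algebra_simps)

lemma cap_prepend [simp]: "cap c (prepend g (prepend h x)) = frag_cmul (c g h) x"
  using subset_UNIV
  by (induction x rule: frag_induction)
     (auto simp: prepend_diff cap_diff frag_cmul_diff_distrib2)

lemma cap_chain:
  assumes "Poly_Mapping.keys x \<subseteq> tuples (Suc (Suc n)) G"
  shows "Poly_Mapping.keys (cap c x) \<subseteq> tuples n G"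
  using assms
  by (induction x rule: frag_induction) (auto simp: cap_diff chains_diff tuples_Suc split: if_splits)

locale two_cocycle = monoid G for G (structure) +
  fixes c :: "'a \<Rightarrow> 'a \<Rightarrow> int"
  assumes cocycle: "\<lbrakk>g \<in> carrier G; h \<in> carrier G; k \<in> carrier G\<rbrakk>
    \<Longrightarrow> c h k + c g (h \<otimes> k) = c (g \<otimes> h) k + c g h"
begin

text \<open>The faces of index 0, 1 and 2 give three terms of the cocycle identity. The fourth is
  the index-0 face of the list \<open>k # ys\<close>, which is just what the other faces lack to
  form its full boundary.\<close>

lemma bar_boundary_cap:
  assumes "Poly_Mapping.keys x \<subseteq> tuples n G" "n \<noteq> 2"
  shows "bar_boundary G (cap c x) = cap c (bar_boundary G x)"
  using assms(1)
proof (induction x rule: frag_induction)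
  case (one xs)
  consider "xs = []" | g where "xs = [g]"
    | g h k ys where "xs = g # h # k # ys"
    using one \<open>n \<noteq> 2\<close>
    by (cases xs rule: remdups_adj.cases; cases "tl (tl xs)") (auto simp: tuples_def)
  then show ?case
  proof cases
    case 3
    then have mem: "g \<in> carrier G" "h \<in> carrier G" "k \<in> carrier G"
      using one by (auto simp: tuples_def)
    let ?y = "frag_of ys"
    have "cap c (bar_boundary G (frag_of xs)) = frag_cmul (c h k) ?y - frag_cmul (c (g \<otimes> h) k) ?y
        + frag_cmul (c g (h \<otimes> k)) ?y
        + (frag_cmul (c g h) (bar_boundary G (frag_of (k # ys))) - frag_cmul (c g h) ?y)"
      unfolding 3 by (simp add: bar_boundary_Cons_Cons[of G g] bar_boundary_Cons_Cons[of G h]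
          cap_linear prepend_linear frag_cmul_diff_distrib2 algebra_simps)
    also have "\<dots> = frag_cmul (c h k + c g (h \<otimes> k) - c (g \<otimes> h) k - c g h) ?y
        + frag_cmul (c g h) (bar_boundary G (frag_of (k # ys)))"
      by (simp add: frag_cmul_distrib frag_cmul_diff_distrib)
    also have "c h k + c g (h \<otimes> k) - c (g \<otimes> h) k - c g h = 0"
      using cocycle[OF mem] by simp
    finally show ?thesis by (simp add: 3 bar_boundary_cmul)
  qed auto
qed (simp_all add: cap_diff bar_boundary_diff)

end

text \<open>The homotopy is the cap product with the 1-cochain \<open>m\<close>.\<close>

lemma cap_coboundary_homotopy:
  assumes G: "monoid G" and x: "Poly_Mapping.keys x \<subseteq> tuples n G" "n \<ge> 2"
    and c': "\<And>g h. g \<in> carrier G \<Longrightarrow> h \<in> carrier G \<Longrightarrow> c' g h = c g h + m g + m h - m (g \<otimes>\<^bsub>G\<^esub> h)"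
  defines "\<eta> \<equiv> frag_extend (\<lambda>xs. case xs of [] \<Rightarrow> 0 | g # ys \<Rightarrow> frag_cmul (m g) (frag_of ys))"
  shows "cap c' x = cap c x + bar_boundary G (\<eta> x) + \<eta> (bar_boundary G x)"
proof -
  have \<eta>_diff: "\<eta> (y - z) = \<eta> y - \<eta> z" and \<eta>_of: "\<eta> (frag_of (g # ys)) = frag_cmul (m g) (frag_of ys)"
    for y z g ys
    by (simp_all add: \<eta>_def frag_extend_diff)
  have \<eta>_prepend: "\<eta> (prepend g y) = frag_cmul (m g) y" for g y
    using subset_UNIV
    by (induction y rule: frag_induction)
       (auto simp: \<eta>_diff \<eta>_of prepend_diff frag_cmul_diff_distrib2, simp add: \<eta>_def)
  show ?thesis
    using x(1)
  proof (induction x rule: frag_induction)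
    case (one xs)
    then obtain g h ys where xs: "xs = g # h # ys"
      using \<open>n \<ge> 2\<close> by (cases xs rule: remdups_adj.cases) (auto simp: tuples_def)
    with one have mem: "g \<in> carrier G" "h \<in> carrier G" by (auto simp: tuples_def)
    show ?case
      by (simp add: xs bar_boundary_Cons_Cons[of G g] \<eta>_diff \<eta>_of \<eta>_prepend bar_boundary_cmul
          c'[OF mem] frag_cmul_distrib frag_cmul_diff_distrib frag_cmul_diff_distrib2)
  qed (simp_all add: \<eta>_diff cap_diff bar_boundary_diff, simp add: \<eta>_def)
qed


section \<open>Cycles and boundaries\<close>

lemma in_bar_cycles_iff:
  "z \<in> bar_cycles n G \<longleftrightarrow> Poly_Mapping.keys z \<subseteq> tuples n G \<and> bar_boundary G z = 0"
  by (simp add: bar_cycles_def bar_chains_def)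

lemma in_bar_boundaries_iff:
  "z \<in> bar_boundaries n G \<longleftrightarrow> (\<exists>w. Poly_Mapping.keys w \<subseteq> tuples (Suc n) G \<and> z = bar_boundary G w)"
  unfolding bar_boundaries_def bar_chains_def carrier_free_Abelian_group_iff image_iff Bex_def ..

lemma bar_boundaries_zero: "0 \<in> bar_boundaries n G"
  by (auto simp: in_bar_boundaries_iff intro!: exI[of _ 0])

lemma bar_boundaries_diff:
  assumes "x \<in> bar_boundaries n G" "y \<in> bar_boundaries n G"
  shows "x - y \<in> bar_boundaries n G"
proof -
  obtain v w where "Poly_Mapping.keys v \<subseteq> tuples (Suc n) G" "x = bar_boundary G v"
    "Poly_Mapping.keys w \<subseteq> tuples (Suc n) G" "y = bar_boundary G w"
    using assms unfolding in_bar_boundaries_iff by blast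
  then show ?thesis
    unfolding in_bar_boundaries_iff
    by (intro exI[of _ "v - w"]) (auto intro!: chains_diff simp: bar_boundary_diff dest: subsetD[OF keys_diff])
qed

lemma bar_boundaries_minus: "x \<in> bar_boundaries n G \<Longrightarrow> - x \<in> bar_boundaries n G"
  using bar_boundaries_diff[OF bar_boundaries_zero, of x] by simp

lemma bar_boundaries_add:
  "x \<in> bar_boundaries n G \<Longrightarrow> y \<in> bar_boundaries n G \<Longrightarrow> x + y \<in> bar_boundaries n G"
  using bar_boundaries_diff[of x n G "- y"] bar_boundaries_minus by fastforce

lemma bar_boundaries_cmul:
  "x \<in> bar_boundaries n G \<Longrightarrow> frag_cmul a x \<in> bar_boundaries n G"
  by (rule frag_closure_minus_cmul) (auto intro: bar_boundaries_zero bar_boundaries_diff)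

lemma bar_cycles_diff: "x \<in> bar_cycles n G \<Longrightarrow> y \<in> bar_cycles n G \<Longrightarrow> x - y \<in> bar_cycles n G"
  by (auto simp: in_bar_cycles_iff bar_boundary_diff dest: subsetD[OF keys_diff])

lemma bar_cycles_cmul: "x \<in> bar_cycles n G \<Longrightarrow> frag_cmul a x \<in> bar_cycles n G"
  by (auto simp: in_bar_cycles_iff bar_boundary_cmul)

lemma bar_boundaries_subset_bar_cycles:
  assumes "monoid G" shows "bar_boundaries n G \<subseteq> bar_cycles n G"
proof
  fix z
  assume "z \<in> bar_boundaries n G"
  then obtain w where w: "Poly_Mapping.keys w \<subseteq> tuples (Suc n) G" "z = bar_boundary G w"
    unfolding in_bar_boundaries_iff by blast
  show "z \<in> bar_cycles n G"
    unfolding in_bar_cycles_iff w(2)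
    using monoid.bar_boundary_bar_boundary[OF assms w(1)] monoid.bar_boundary_chain[OF assms w(1)]
    by simp
qed

context two_cocycle begin

lemma cap_bar_cycles:
  assumes "z \<in> bar_cycles (Suc (Suc n)) G" "n \<ge> 1"
  shows "cap c z \<in> bar_cycles n G"
  using assms bar_boundary_cap[of z "Suc (Suc n)"] cap_chain[of z n]
  by (auto simp: in_bar_cycles_iff)

lemma cap_bar_boundaries:
  assumes "z \<in> bar_boundaries (Suc (Suc n)) G"
  shows "cap c z \<in> bar_boundaries n G"
proof -
  obtain w where w: "Poly_Mapping.keys w \<subseteq> tuples (Suc (Suc (Suc n))) G" "z = bar_boundary G w"
    using assms unfolding in_bar_boundaries_iff by blast
  then show ?thesis
    unfolding in_bar_boundaries_iff
    using bar_boundary_cap[OF w(1)] cap_chain[OF w(1)] by (intro exI[of _ "cap c w"]) auto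
qed

end

text \<open>On a cycle one half of the chain homotopy vanishes, so in homology the cap product sees
  only the class of the cocycle. This allows a representative adapted to cyclic groups.\<close>

lemma cap_cohomologous:
  assumes G: "monoid G" and z: "z \<in> bar_cycles (Suc (Suc n)) G"
    and c': "\<And>g h. g \<in> carrier G \<Longrightarrow> h \<in> carrier G \<Longrightarrow> c' g h = c g h + m g + m h - m (g \<otimes>\<^bsub>G\<^esub> h)"
  shows "cap c' z - cap c z \<in> bar_boundaries n G"
proof -
  define \<eta> where "\<eta> = frag_extend (\<lambda>xs. case xs of [] \<Rightarrow> 0 | g # ys \<Rightarrow> frag_cmul (m g) (frag_of ys))"
  have z': "Poly_Mapping.keys z \<subseteq> tuples (Suc (Suc n)) G" "bar_boundary G z = 0"
    using z by (auto simp: in_bar_cycles_iff)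
  have "cap c' z = cap c z + bar_boundary G (\<eta> z)"
    using cap_coboundary_homotopy[where c = c and c' = c' and m = m, OF G z'(1)] c' z'(2)
    by (simp add: \<eta>_def)
  moreover have "Poly_Mapping.keys (\<eta> z) \<subseteq> tuples (Suc n) G"
    using z'(1)
  proof (induction z rule: frag_induction)
    case (one xs)
    then show ?case by (auto simp: \<eta>_def tuples_Suc split: if_splits)
  qed (simp_all add: \<eta>_def frag_extend_diff chains_diff)
  ultimately show ?thesis
    unfolding in_bar_boundaries_iff by (intro exI[of _ "\<eta> z"]) simp
qed


section \<open>Evaluating cochains on chains\<close>

definition pairing :: "('a \<Rightarrow> 'r::comm_ring_1) \<Rightarrow> ('a \<Rightarrow>\<^sub>0 int) \<Rightarrow> 'r" where
  "pairing f z = (\<Sum>x\<in>Poly_Mapping.keys z. of_int (Poly_Mapping.lookup z x) * f x)"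

lemma pairing_superset:
  assumes "finite A" "Poly_Mapping.keys z \<subseteq> A"
  shows "pairing f z = (\<Sum>x\<in>A. of_int (Poly_Mapping.lookup z x) * f x)"
  unfolding pairing_def using assms
  by (intro sum.mono_neutral_left) (auto simp: in_keys_iff)

lemma pairing_zero [simp]: "pairing f 0 = 0"
  by (simp add: pairing_def)

lemma pairing_frag_of [simp]: "pairing f (frag_of x) = f x"
  by (simp add: pairing_def)

lemma pairing_diff: "pairing f (y - z) = pairing f y - pairing f z"
proof -
  let ?A = "Poly_Mapping.keys y \<union> Poly_Mapping.keys z"
  have "pairing f (y - z) = (\<Sum>x\<in>?A. of_int (Poly_Mapping.lookup (y - z) x) * f x)"
    by (rule pairing_superset) (use keys_diff[of y z] in auto)
  also have "\<dots> = pairing f y - pairing f z"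
    by (simp add: pairing_superset[of ?A] lookup_minus left_diff_distrib sum_subtractf)
  finally show ?thesis .
qed

lemma pairing_minus: "pairing f (- z) = - pairing f z"
  using pairing_diff[of f 0 z] by simp

lemma pairing_add: "pairing f (y + z) = pairing f y + pairing f z"
  using pairing_diff[of f y "- z"] by (simp add: pairing_minus)

lemma pairing_sum: "pairing f (sum g I) = (\<Sum>i\<in>I. pairing f (g i))"
  by (induction I rule: infinite_finite_induct) (simp_all add: pairing_add)

lemma pairing_cmul: "pairing f (frag_cmul a z) = of_int a * pairing f z"
proof -
  have "pairing f (frag_cmul a z)
      = (\<Sum>x\<in>Poly_Mapping.keys z. of_int (Poly_Mapping.lookup (frag_cmul a z) x) * f x)"
    by (rule pairing_superset) auto
  then show ?thesis by (simp add: pairing_def sum_distrib_left mult.assoc)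
qed

lemma pairing_cong:
  assumes "Poly_Mapping.keys z \<subseteq> S" "\<And>x. x \<in> S \<Longrightarrow> f x = g x"
  shows "pairing f z = pairing g z"
  unfolding pairing_def by (rule sum.cong) (use assms in auto)

lemma pairing_Ints:
  assumes "Poly_Mapping.keys z \<subseteq> S" "\<And>x. x \<in> S \<Longrightarrow> f x \<in> \<int>"
  shows "pairing f z \<in> \<int>"
  unfolding pairing_def by (rule Ints_sum) (use assms in auto)


section \<open>The homology of the rationals modulo the integers\<close>

lemma sum_periodic_shift:
  fixes f :: "nat \<Rightarrow> 'b::ab_group_add"
  assumes "\<And>i. f (i + n) = f i"
  shows "(\<Sum>i<n. f (i + j)) = (\<Sum>i<n. f i)"
proof -
  have "(\<Sum>i<j. f i) + (\<Sum>i<n. f (i + j)) = (\<Sum>i<n + j. f i)"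
    by (induction n) (simp_all add: add.assoc)
  also have "\<dots> = (\<Sum>i<n. f i) + (\<Sum>i<j. f (i + n))"
    by (induction j) (simp_all add: add_ac)
  finally show ?thesis using assms by simp
qed

text \<open>Addition with carry: runs of lengths \<open>b\<close> and \<open>a\<close> join to a run
  of length \<open>a + b\<close>, from which a full period splits off exactly when there is a
  carry.\<close>

lemma sum_periodic_concat:
  fixes f :: "nat \<Rightarrow> 'b::ab_group_add"
  assumes "\<And>i. f (i + n) = f i" "a < n" "b < n"
  shows "(\<Sum>i<a. f (i + b)) + (\<Sum>i<b. f i)
    = (\<Sum>i<(a + b) mod n. f i) + (if a + b < n then 0 else \<Sum>i<n. f i)"
proof -
  have 1: "(\<Sum>i<a. f (i + b)) + (\<Sum>i<b. f i) = (\<Sum>i<a + b. f i)"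
    by (induction a) (simp_all add: add_ac)
  have 2: "(\<Sum>i<n + r. f i) = (\<Sum>i<r. f (i + n)) + (\<Sum>i<n. f i)" for r
    by (induction r) (simp_all add: add_ac)
  show ?thesis
  proof (cases "a + b < n")
    case True
    then show ?thesis by (simp add: 1)
  next
    case False
    then have "a + b = n + (a + b - n)" "(a + b) mod n = a + b - n"
      using assms by (simp_all add: le_mod_geq)
    then show ?thesis using 1 2[of "a + b - n"] assms(1) False by simp
  qed
qed

text \<open>An abstract copy of Q/Z: \<open>e\<close> presents it as a quotient of the rationals,
  \<open>\<sigma>\<close> is a set-theoretic section of \<open>e\<close>, and \<open>c\<close> is
  its coboundary. The section is arbitrary, not the fractional part, because it will come from an
  arbitrary choice of lifts of diffeomorphisms.\<close>

locale rational_circle = monoid C for C (structure) +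
  fixes e :: "rat \<Rightarrow> 'a" and \<sigma> :: "'a \<Rightarrow> rat" and c :: "'a \<Rightarrow> 'a \<Rightarrow> int"
  assumes carrier_eq: "carrier C = range e"
    and e_add: "e (x + y) = e x \<otimes> e y"
    and e_eq_iff: "e x = e y \<longleftrightarrow> x - y \<in> \<int>"
    and e_sigma: "g \<in> carrier C \<Longrightarrow> e (\<sigma> g) = g"
    and c_eq: "\<lbrakk>g \<in> carrier C; h \<in> carrier C\<rbrakk> \<Longrightarrow> of_int (c g h) = \<sigma> g + \<sigma> h - \<sigma> (g \<otimes> h)"
begin

lemma e_closed [simp]: "e x \<in> carrier C"
  by (simp add: carrier_eq)

lemma e_0: "e 0 = \<one>"
proof -
  obtain x where "\<one> = e x" using one_closed carrier_eq by blast
  then show ?thesis using e_add[of 0 x] r_one[OF e_closed[of 0]] by simp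
qed

sublocale two_cocycle C c
proof
  fix g h k
  assume "g \<in> carrier C" "h \<in> carrier C" "k \<in> carrier C"
  then have "(of_int (c h k + c g (h \<otimes> k)) :: rat) = of_int (c (g \<otimes> h) k + c g h)"
    by (simp add: c_eq m_assoc)
  then show "c h k + c g (h \<otimes> k) = c (g \<otimes> h) k + c g h"
    by (simp only: of_int_eq_iff)
qed

text \<open>The cocycle that the section with values in [0,1) would give. It differs from
  \<open>c\<close> by the coboundary of an integral cochain, and on roots of unity it is the carry
  of addition modulo n.\<close>

definition cfrac :: "'a \<Rightarrow> 'a \<Rightarrow> int" where
  "cfrac g h = c g h - \<lfloor>\<sigma> g\<rfloor> - \<lfloor>\<sigma> h\<rfloor> + \<lfloor>\<sigma> (g \<otimes> h)\<rfloor>"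

lemma of_int_cfrac:
  "\<lbrakk>g \<in> carrier C; h \<in> carrier C\<rbrakk>
    \<Longrightarrow> of_int (cfrac g h) = frac (\<sigma> g) + frac (\<sigma> h) - frac (\<sigma> (g \<otimes> h))"
  by (simp add: cfrac_def c_eq frac_def)

lemma frac_sigma: "frac (\<sigma> (e x)) = frac x"
proof -
  have "\<sigma> (e x) - x \<in> \<int>" using e_eq_iff[of "\<sigma> (e x)" x] e_sigma[of "e x"] by simp
  then obtain m where "\<sigma> (e x) = x + of_int m" by (auto simp: Ints_def algebra_simps)
  then show ?thesis by (simp add: frac_def)
qed

lemma cap_cfrac:
  assumes "z \<in> bar_cycles (Suc (Suc m)) C"
  shows "cap c z - cap cfrac z \<in> bar_boundaries m C"
  by (rule cap_cohomologous[OF monoid_axioms assms, of _ _ "\<lambda>g. \<lfloor>\<sigma> g\<rfloor>"]) (simp add: cfrac_def)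

section \<open>The cyclic subgroup of order n and its periodicity\<close>

context
  fixes n :: nat
  assumes n: "n \<ge> 2"
begin

text \<open>The n-th roots of unity. The bound n \<ge> 2 keeps the index of \<open>zeta 1\<close>
  below n; for n = 1 no carry would ever occur.\<close>

definition zeta :: "nat \<Rightarrow> 'a" where
  "zeta i = e (of_nat i / of_nat n)"

definition zeta_index :: "'a \<Rightarrow> nat" where
  "zeta_index g = nat \<lfloor>of_nat n * frac (\<sigma> g)\<rfloor>"

lemma zeta_closed [simp]: "zeta i \<in> carrier C"
  by (simp add: zeta_def)

lemma zeta_0: "zeta 0 = \<one>"
  by (simp add: zeta_def e_0)

lemma zeta_add: "zeta i \<otimes> zeta j = zeta (i + j)"
  by (simp add: zeta_def add_divide_distrib flip: e_add)

lemma zeta_periodic: "zeta (i + n) = zeta i"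
  using n by (simp add: zeta_def e_eq_iff add_divide_distrib)

lemma zeta_mod: "zeta (i mod n) = zeta i"
proof -
  have "zeta (j + k * n) = zeta j" for j k
    by (induction k) (simp_all add: zeta_periodic add.assoc[symmetric] add.commute[of n])
  from this[of "i mod n" "i div n"] show ?thesis by simp
qed

lemma frac_sigma_zeta: "i < n \<Longrightarrow> frac (\<sigma> (zeta i)) = of_nat i / of_nat n"
  unfolding zeta_def frac_sigma by (simp add: frac_eq)

lemma zeta_index_zeta: "i < n \<Longrightarrow> zeta_index (zeta i) = i"
  using n by (simp add: zeta_index_def frac_sigma_zeta)

lemma zetaE:
  assumes "g \<in> range zeta"
  obtains i where "i < n" "g = zeta i"
proof -
  obtain j where "g = zeta j" using assms by blast
  then have "g = zeta (j mod n)" by (simp add: zeta_mod)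
  then show ?thesis using that[of "j mod n"] n by simp
qed

lemma cfrac_zeta:
  assumes "a < n" "b < n"
  shows "cfrac (zeta a) (zeta b) = (if a + b < n then 0 else 1)"
proof -
  have "(of_int (cfrac (zeta a) (zeta b)) :: rat)
      = (of_nat a + of_nat b - of_nat ((a + b) mod n)) / of_nat n"
    using assms frac_sigma_zeta[of "(a + b) mod n"] n
    by (simp add: of_int_cfrac frac_sigma_zeta zeta_add zeta_mod add_divide_distrib diff_divide_distrib)
  also have "\<dots> = of_int (if a + b < n then 0 else 1)"
  proof (cases "a + b < n")
    case False
    then have "(a + b) mod n = a + b - n" using assms by (simp add: le_mod_geq)
    then show ?thesis using False n by (simp add: of_nat_diff)
  qed simp
  finally show ?thesis by (simp only: of_int_eq_iff)
qed

text \<open>\<open>stair n\<close> is a chain map in positive degrees that realizes the periodicity of the homology of the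
  cyclic group; its iterates send the bar generator of a root of unity to the fundamental cycles of
  lens spaces.\<close>

definition stair :: "nat \<Rightarrow> ('a list \<Rightarrow>\<^sub>0 int) \<Rightarrow> ('a list \<Rightarrow>\<^sub>0 int)" where
  "stair a x = (\<Sum>i<a. prepend (zeta 1) (prepend (zeta i) x))"

lemma stair_zero [simp]: "stair a 0 = 0"
  by (simp add: stair_def)

lemma stair_diff: "stair a (x - y) = stair a x - stair a y"
  by (simp add: stair_def prepend_diff sum_subtractf)

lemma stair_chain:
  assumes "Poly_Mapping.keys x \<subseteq> tuples m C"
  shows "Poly_Mapping.keys (stair a x) \<subseteq> tuples (Suc (Suc m)) C"
  unfolding stair_def by (intro chains_sum prepend_chain assms) auto

text \<open>Adding 1 to i < n produces a carry only for i = n - 1, so exactly one summand survives,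
  with coefficient 1. The identity holds on chains and will give surjectivity of the cap product in
  homology.\<close>

lemma cap_stair: "cap cfrac (stair n x) = x"
proof -
  have "cap cfrac (stair n x) = (\<Sum>i<n. frag_cmul (cfrac (zeta 1) (zeta i)) x)"
    by (simp add: stair_def cap_sum)
  also have "\<dots> = (\<Sum>i<n. if i = n - 1 then x else 0)"
    by (rule sum.cong) (use n in \<open>auto simp: cfrac_zeta\<close>)
  finally show ?thesis using n by simp
qed

text \<open>Summed over i, the first two faces telescope and the third turns \<open>zeta i\<close>
  into \<open>zeta (i + b)\<close>. For a = n the two ends agree and the shifted sum is again a full
  period, which is why \<open>stair n\<close> commutes with the boundary.\<close>

lemma bar_boundary_stair_Cons:
  "bar_boundary C (stair a (frag_of (zeta b # ys))) =
     frag_of (zeta 0 # zeta b # ys) - frag_of (zeta a # zeta b # ys)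
     + (\<Sum>i<a. frag_of (zeta 1 # zeta (i + b) # ys))
     + stair a (bar_boundary C (frag_of (zeta b # ys)) - frag_of ys)"
proof -
  let ?Y = "bar_boundary C (frag_of (zeta b # ys)) - frag_of ys"
  have "bar_boundary C (frag_of (zeta 1 # zeta i # zeta b # ys))
      = (frag_of (zeta i # zeta b # ys) - frag_of (zeta (Suc i) # zeta b # ys))
      + frag_of (zeta 1 # zeta (i + b) # ys) + prepend (zeta 1) (prepend (zeta i) ?Y)" for i
    by (simp add: bar_boundary_Cons_Cons[of C "zeta (Suc 0)"] bar_boundary_Cons_Cons[of C "zeta i"]
        zeta_add prepend_linear)
  then show ?thesis
    using sum_lessThan_telescope'[of "\<lambda>i. frag_of (zeta i # zeta b # ys)" a]
    by (simp add: stair_def bar_boundary_sum sum.distrib flip: prepend_diff)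
qed

definition zeta_lists :: "nat \<Rightarrow> 'a list set" where
  "zeta_lists m = {xs. length xs = m \<and> set xs \<subseteq> range zeta}"

lemma zeta_lists_Suc: "zeta_lists (Suc m) = {g # xs |g xs. g \<in> range zeta \<and> xs \<in> zeta_lists m}"
  by (auto simp: zeta_lists_def length_Suc_conv)

lemma bar_boundary_stair:
  assumes "Poly_Mapping.keys x \<subseteq> zeta_lists (Suc m)"
  shows "bar_boundary C (stair n x) = stair n (bar_boundary C x)"
  using assms
proof (induction x rule: frag_induction)
  case (one xs)
  then obtain b ys where xs: "xs = zeta b # ys" by (auto simp: zeta_lists_Suc)
  have "(\<Sum>i<n. frag_of (zeta 1 # zeta (i + b) # ys)) = (\<Sum>i<n. frag_of (zeta 1 # zeta i # ys))"
    by (rule sum_periodic_shift) (simp add: zeta_periodic)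
  also have "\<dots> = stair n (frag_of ys)" by (simp add: stair_def)
  finally show ?case
    unfolding xs bar_boundary_stair_Cons using zeta_periodic[of 0] by (simp add: stair_diff)
qed (simp_all add: stair_diff bar_boundary_diff)

text \<open>Telescoping a staircase of length \<open>zeta_index g\<close> trades a leading
  \<open>g\<close> for a leading unit. The list with the leading unit is degenerate but not zero
  here; the summand with two units in front is there to cancel it.\<close>

definition contraction :: "('a list \<Rightarrow>\<^sub>0 int) \<Rightarrow> ('a list \<Rightarrow>\<^sub>0 int)" where
  "contraction = frag_extend (\<lambda>xs. case xs of [] \<Rightarrow> 0
     | g # ys \<Rightarrow> frag_of (\<one> # \<one> # ys) - stair (zeta_index g) (frag_of ys))"

lemma contraction_diff: "contraction (x - y) = contraction x - contraction y"
  by (simp add: contraction_def frag_extend_diff)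

lemma contraction_zero [simp]: "contraction 0 = 0"
  by (simp add: contraction_def)

lemma contraction_Cons:
  "contraction (frag_of (g # ys)) = frag_of (\<one> # \<one> # ys) - stair (zeta_index g) (frag_of ys)"
  by (simp add: contraction_def)

lemma contraction_prepend:
  "contraction (prepend g x) = prepend \<one> (prepend \<one> x) - stair (zeta_index g) x"
  using subset_UNIV
  by (induction x rule: frag_induction)
     (auto simp: contraction_diff contraction_Cons prepend_diff stair_diff)

lemma contraction_chain:
  assumes "Poly_Mapping.keys x \<subseteq> tuples (Suc m) C"
  shows "Poly_Mapping.keys (contraction x) \<subseteq> tuples (Suc (Suc m)) C"
  using assms
proof (induction x rule: frag_induction)
  case (one xs)
  then obtain g ys where "xs = g # ys" "ys \<in> tuples m C" by (auto simp: tuples_Suc)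
  then show ?case
    by (simp add: contraction_Cons chains_diff stair_chain)
qed (simp_all add: contraction_diff chains_diff)

text \<open>The counterpart of \<open>cap_stair\<close>: on cycles of degree at least 2,
  \<open>stair n\<close> undoes the cap product up to a boundary.\<close>

lemma contraction_homotopy:
  assumes "Poly_Mapping.keys x \<subseteq> zeta_lists (Suc (Suc m))"
  shows "bar_boundary C (contraction x) + contraction (bar_boundary C x) = x - stair n (cap cfrac x)"
  using assms
proof (induction x rule: frag_induction)
  case (one xs)
  then obtain g h ys where xs: "xs = g # h # ys" and gh: "g \<in> range zeta" "h \<in> range zeta"
    by (auto simp: zeta_lists_Suc)
  obtain a where a: "a < n" "g = zeta a" using gh(1) by (rule zetaE)
  obtain b where b: "b < n" "h = zeta b" using gh(2) by (rule zetaE)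
  define Y where "Y = bar_boundary C (frag_of (h # ys)) - frag_of ys"
  let ?X = "frag_of ys"
  let ?f = "\<lambda>i. frag_of (zeta 1 # zeta i # ys)"
  have sum_f: "(\<Sum>i<j. ?f i) = stair j ?X" for j
    by (simp add: stair_def)
  have "(\<Sum>i<a. ?f (i + b)) + (\<Sum>i<b. ?f i)
      = (\<Sum>i<(a + b) mod n. ?f i) + (if a + b < n then 0 else \<Sum>i<n. ?f i)"
    by (rule sum_periodic_concat) (use a b in \<open>simp_all add: zeta_periodic\<close>)
  \<comment> \<open>The carry is \<open>cfrac g h\<close>, so the full period that splits off is the
    staircase over the cap product.\<close>
  then have key: "(\<Sum>i<a. ?f (i + b)) = stair ((a + b) mod n) ?X - stair b ?X + stair n (cap cfrac (frag_of xs))"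
    unfolding sum_f by (simp add: xs a b cfrac_zeta algebra_simps)
  have "bar_boundary C (frag_of (\<one> # \<one> # h # ys)) = frag_of (\<one> # h # ys) + prepend \<one> (prepend \<one> Y)"
    using b by (simp add: bar_boundary_Cons_Cons[of C \<one>] Y_def prepend_linear)
  then have 1: "bar_boundary C (contraction (frag_of xs)) = prepend \<one> (prepend \<one> Y)
      + frag_of xs - (\<Sum>i<a. ?f (i + b)) - stair a Y"
    using a b bar_boundary_stair_Cons[of a b ys]
    by (simp add: xs contraction_Cons bar_boundary_diff zeta_index_zeta Y_def zeta_0)
  have "zeta_index (g \<otimes> h) = (a + b) mod n"
    using a b n zeta_index_zeta[of "(a + b) mod n"] by (simp add: zeta_add zeta_mod)
  then have 2: "contraction (bar_boundary C (frag_of xs))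
      = stair ((a + b) mod n) ?X - stair b ?X - prepend \<one> (prepend \<one> Y) + stair a Y"
    using a b
    by (simp add: xs bar_boundary_Cons_Cons[of C "zeta a"] contraction_diff contraction_Cons
        contraction_prepend zeta_index_zeta Y_def)
  show ?case unfolding 1 2 key by simp
next
  case (diff y z)
  have "bar_boundary C (contraction (y - z)) + contraction (bar_boundary C (y - z))
      = (bar_boundary C (contraction y) + contraction (bar_boundary C y))
        - (bar_boundary C (contraction z) + contraction (bar_boundary C z))"
    by (simp add: contraction_diff bar_boundary_diff)
  then show ?case by (simp only: diff.IH) (simp add: cap_diff stair_diff)
qed simp

text \<open>In degree 0 the last face deletes \<open>zeta i\<close>, so the sum counts
  \<open>[zeta 1]\<close> repeatedly instead of shifting indices. The resulting relation expresses
  \<open>zeta a\<close> through the generator in degree one.\<close>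

lemma bar_boundary_stair_Nil:
  "bar_boundary C (stair a (frag_of [])) = frag_of [\<one>] - frag_of [zeta a] + frag_cmul (int a) (frag_of [zeta 1])"
proof -
  have "bar_boundary C (frag_of [zeta 1, zeta i]) = (frag_of [zeta i] - frag_of [zeta (Suc i)]) + frag_of [zeta 1]" for i
    by (simp add: bar_boundary_Cons_Cons zeta_add prepend_minus)
  moreover have "(\<Sum>i<a. frag_of [zeta 1]) = frag_cmul (int a) (frag_of [zeta 1])"
    by (induction a) (simp_all add: frag_cmul_distrib)
  ultimately show ?thesis
    using sum_lessThan_telescope'[of "\<lambda>i. frag_of [zeta i]" a]
    by (simp add: stair_def bar_boundary_sum sum.distrib zeta_0)
qed

lemma bar_boundaries_singleton_one: "frag_of [\<one>] \<in> bar_boundaries 1 C"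
  unfolding in_bar_boundaries_iff
  by (rule exI[of _ "frag_of [\<one>, \<one>]"]) (simp add: bar_boundary_Cons_Cons prepend_minus)

lemma zeta_singleton_homologous:
  "frag_of [zeta a] - frag_cmul (int a) (frag_of [zeta 1]) \<in> bar_boundaries 1 C"
proof -
  have "Poly_Mapping.keys (stair a (frag_of [])) \<subseteq> tuples (Suc 1) C"
    using stair_chain[of "frag_of []" 0 a] by simp
  then have "frag_of [\<one>] - frag_of [zeta a] + frag_cmul (int a) (frag_of [zeta 1]) \<in> bar_boundaries 1 C"
    using bar_boundary_stair_Nil[of a] unfolding in_bar_boundaries_iff by metis
  from bar_boundaries_diff[OF bar_boundaries_singleton_one this] show ?thesis by simp
qed

text \<open>A list \<open>[zeta a]\<close> contributes a to the multiplicity \<open>k\<close> and,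
  up to an integer, a/n to the pairing. So the pairing determines \<open>k\<close> modulo n, which
  is all that matters in homology.\<close>

lemma zeta_homologous:
  assumes "Poly_Mapping.keys z \<subseteq> zeta_lists 1"
  shows "\<exists>k. z - frag_cmul k (frag_of [zeta 1]) \<in> bar_boundaries 1 C
           \<and> pairing (\<lambda>xs. \<sigma> (hd xs)) z - of_int k / of_nat n \<in> \<int>"
  using assms
proof (induction z rule: frag_induction)
  case zero
  show ?case by (rule exI[of _ 0]) (simp add: bar_boundaries_zero)
next
  case (one xs)
  then obtain g where xs: "xs = [g]" "g \<in> range zeta"
    by (auto simp: zeta_lists_def length_Suc_conv)
  obtain a where a: "a < n" "g = zeta a" using xs(2) by (rule zetaE)
  have "\<sigma> g - of_nat a / of_nat n = of_int \<lfloor>\<sigma> g\<rfloor>"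
    using frac_sigma_zeta[OF a(1)] by (simp add: a(2) frac_def algebra_simps)
  then have "\<sigma> g - of_nat a / of_nat n \<in> \<int>" by simp
  then show ?case
    using zeta_singleton_homologous[of a] by (intro exI[of _ "int a"]) (simp add: xs(1) a(2))
next
  case (diff y z)
  then obtain k l where
    "y - frag_cmul k (frag_of [zeta 1]) \<in> bar_boundaries 1 C"
    "z - frag_cmul l (frag_of [zeta 1]) \<in> bar_boundaries 1 C"
    and *: "pairing (\<lambda>xs. \<sigma> (hd xs)) y - of_int k / of_nat n \<in> \<int>"
    "pairing (\<lambda>xs. \<sigma> (hd xs)) z - of_int l / of_nat n \<in> \<int>"
    by blast
  from bar_boundaries_diff[OF this(1,2)] Ints_diff[OF *] show ?case
    by (intro exI[of _ "k - l"])
       (simp add: pairing_diff frag_cmul_diff_distrib diff_divide_distrib algebra_simps)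
qed

lemma zeta_bar_boundary:
  assumes "Poly_Mapping.keys z \<subseteq> zeta_lists 1" "pairing (\<lambda>xs. \<sigma> (hd xs)) z \<in> \<int>"
  shows "z \<in> bar_boundaries 1 C"
proof -
  let ?t = "frag_of [zeta 1]"
  obtain k where k: "z - frag_cmul k ?t \<in> bar_boundaries 1 C"
    "pairing (\<lambda>xs. \<sigma> (hd xs)) z - of_int k / of_nat n \<in> \<int>"
    using zeta_homologous[OF assms(1)] by blast
  have "of_int k / (of_nat n :: rat) \<in> \<int>"
    using Ints_diff[OF assms(2) k(2)] by simp
  then obtain j where "of_int k / (of_nat n :: rat) = of_int j" by (auto simp: Ints_def)
  then have "(of_int k :: rat) = of_int (j * int n)" using n by (simp add: field_simps)
  then have j: "k = j * int n" by (simp only: of_int_eq_iff)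
  \<comment> \<open>The n-fold generator bounds because \<open>zeta n\<close> is the unit.\<close>
  have "frag_of [\<one>] - frag_cmul (int n) ?t \<in> bar_boundaries 1 C"
    using zeta_singleton_homologous[of n] zeta_periodic[of 0] by (simp add: zeta_0)
  from bar_boundaries_diff[OF bar_boundaries_singleton_one this]
  have "frag_cmul (int n) ?t \<in> bar_boundaries 1 C" by simp
  from bar_boundaries_cmul[OF this, of j] have "frag_cmul k ?t \<in> bar_boundaries 1 C"
    by (simp add: j)
  from bar_boundaries_add[OF k(1) this] show ?thesis by simp
qed

end

section \<open>From the finite cyclic subgroups to their union\<close>

lemma common_denominator:
  assumes "finite K" "K \<subseteq> carrier C"
  obtains n where "n \<ge> 2" "K \<subseteq> range (zeta n)"
proof -
  have "\<exists>n\<ge>2. K \<subseteq> range (zeta n)"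
    using assms
  proof (induction K rule: finite_induct)
    case (insert g K)
    then obtain n where n: "n \<ge> 2" "K \<subseteq> range (zeta n)" by auto
    define q where "q = frac (\<sigma> g)"
    have "\<sigma> g - q \<in> \<int>" by (simp add: q_def frac_def)
    then have g: "g = e q" using e_eq_iff[of "\<sigma> g" q] e_sigma[of g] insert.prems by simp
    obtain a d where ad: "q = of_int a / of_int d" "d > 0"
      using quotient_of_div[of q] quotient_of_denom_pos'[of q] by (metis prod.collapse)
    have "a \<ge> 0" using frac_ge_0[of "\<sigma> g"] ad by (simp add: q_def[symmetric] zero_le_divide_iff)
    define d' where "d' = nat d"
    have d': "d' > 0" "q = of_nat (nat a) / of_nat d'" using ad \<open>a \<ge> 0\<close> by (simp_all add: d'_def)
    have nd: "n * d' \<ge> 2" using mult_le_mono[OF n(1), of 1 d'] d'(1) by simp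
    have "zeta n i \<in> range (zeta (n * d'))" for i
      by (rule image_eqI[of _ _ "i * d'"]) (use d' in \<open>simp_all add: zeta_def[OF n(1)] zeta_def[OF nd]\<close>)
    moreover have "g \<in> range (zeta (n * d'))"
      by (rule image_eqI[of _ _ "nat a * n"]) (use n(1) d' in \<open>simp_all add: zeta_def[OF nd] g\<close>)
    ultimately show ?case using n(2) nd by (intro exI[of _ "n * d'"]) auto
  qed auto
  with that show ?thesis by blast
qed

text \<open>Two chains at once, because a cycle and a chain bounding its cap product must be placed
  in the same cyclic subgroup.\<close>

lemma chain_common_denominator:
  assumes "Poly_Mapping.keys x \<subseteq> tuples m C" "Poly_Mapping.keys y \<subseteq> tuples l C"
  obtains n where "n \<ge> 2" "Poly_Mapping.keys x \<subseteq> zeta_lists n m" "Poly_Mapping.keys y \<subseteq> zeta_lists n l"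
proof -
  let ?K = "\<Union>xs \<in> Poly_Mapping.keys x \<union> Poly_Mapping.keys y. set xs"
  obtain n where n: "n \<ge> 2" "?K \<subseteq> range (zeta n)"
    by (rule common_denominator[of ?K]) (use assms in \<open>auto simp: tuples_def\<close>)
  have "Poly_Mapping.keys x \<subseteq> zeta_lists n m" "Poly_Mapping.keys y \<subseteq> zeta_lists n l"
    using assms n unfolding zeta_lists_def[OF n(1)] tuples_def by blast+
  with n(1) that show ?thesis by blast
qed

text \<open>For a cycle the homotopy writes \<open>z\<close> as a boundary plus the staircase over
  its cap product. If the cap product bounds \<open>w\<close>, that staircase bounds the staircase
  over \<open>w\<close>.\<close>

lemma cap_homology_inj:
  assumes z: "z \<in> bar_cycles (Suc (Suc (Suc m))) C" and "cap c z \<in> bar_boundaries (Suc m) C"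
  shows "z \<in> bar_boundaries (Suc (Suc (Suc m))) C"
proof -
  have "cap cfrac z \<in> bar_boundaries (Suc m) C"
    using bar_boundaries_diff[OF assms(2) cap_cfrac[OF z]] by simp
  then obtain w where w: "Poly_Mapping.keys w \<subseteq> tuples (Suc (Suc m)) C" "cap cfrac z = bar_boundary C w"
    unfolding in_bar_boundaries_iff by blast
  have z': "Poly_Mapping.keys z \<subseteq> tuples (Suc (Suc (Suc m))) C" "bar_boundary C z = 0"
    using z by (auto simp: in_bar_cycles_iff)
  obtain n where n: "n \<ge> 2" "Poly_Mapping.keys z \<subseteq> zeta_lists n (Suc (Suc (Suc m)))"
    "Poly_Mapping.keys w \<subseteq> zeta_lists n (Suc (Suc m))"
    by (rule chain_common_denominator[OF z'(1) w(1)])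
  have "bar_boundary C (contraction n z) = z - stair n n (bar_boundary C w)"
    using contraction_homotopy[OF n(1,2)] z'(2) n(1) by (simp add: w(2) contraction_zero)
  then have "z = bar_boundary C (contraction n z + stair n n w)"
    using bar_boundary_stair[OF n(1,3)] by (simp add: bar_boundary_add)
  moreover have "Poly_Mapping.keys (contraction n z + stair n n w) \<subseteq> tuples (Suc (Suc (Suc (Suc m)))) C"
    by (intro chains_add contraction_chain stair_chain n(1) z'(1) w(1))
  ultimately show ?thesis unfolding in_bar_boundaries_iff by blast
qed

lemma cap_homology_surj:
  assumes y: "y \<in> bar_cycles (Suc m) C"
  obtains z where "z \<in> bar_cycles (Suc (Suc (Suc m))) C" "cap c z - y \<in> bar_boundaries (Suc m) C"
proof -
  have y': "Poly_Mapping.keys y \<subseteq> tuples (Suc m) C" "bar_boundary C y = 0"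
    using y by (auto simp: in_bar_cycles_iff)
  obtain n where n: "n \<ge> 2" "Poly_Mapping.keys y \<subseteq> zeta_lists n (Suc m)"
    by (rule chain_common_denominator[OF y'(1) y'(1)])
  have cyc: "stair n n y \<in> bar_cycles (Suc (Suc (Suc m))) C"
    unfolding in_bar_cycles_iff
    using bar_boundary_stair[OF n] y'(2) stair_chain[OF n(1) y'(1)] n(1) by (simp add: stair_zero)
  show ?thesis
    by (rule that[OF cyc]) (use cap_cfrac[OF cyc] cap_stair[OF n(1)] in simp)
qed

definition degree_one_value :: "('a list \<Rightarrow>\<^sub>0 int) \<Rightarrow> rat" where
  "degree_one_value = pairing (\<lambda>xs. \<sigma> (hd xs))"

text \<open>This is \<delta>\<sigma> = c. The right side is an integer although
  \<open>\<sigma>\<close> is only rational, so the value modulo the integers descends to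
  homology.\<close>

lemma degree_one_value_bar_boundary:
  assumes "Poly_Mapping.keys w \<subseteq> tuples (Suc (Suc 0)) C"
  shows "degree_one_value (bar_boundary C w) = pairing (\<lambda>xs. of_int (c (xs ! 0) (xs ! 1))) w"
  using assms
proof (induction w rule: frag_induction)
  case (one xs)
  then show ?case
    by (auto simp: tuples_Suc degree_one_value_def bar_boundary_Cons_Cons pairing_add pairing_diff
        pairing_minus prepend_minus c_eq)
qed (simp_all add: degree_one_value_def bar_boundary_diff pairing_diff)

lemma degree_one_boundary_iff:
  assumes "Poly_Mapping.keys z \<subseteq> tuples (Suc 0) C"
  shows "z \<in> bar_boundaries (Suc 0) C \<longleftrightarrow> degree_one_value z \<in> \<int>"
proof
  assume "z \<in> bar_boundaries (Suc 0) C"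
  then obtain w where w: "Poly_Mapping.keys w \<subseteq> tuples (Suc (Suc 0)) C" "z = bar_boundary C w"
    unfolding in_bar_boundaries_iff by blast
  show "degree_one_value z \<in> \<int>"
    unfolding w(2) degree_one_value_bar_boundary[OF w(1)] by (rule pairing_Ints[OF w(1)]) simp
next
  assume *: "degree_one_value z \<in> \<int>"
  obtain n where n: "n \<ge> 2" "Poly_Mapping.keys z \<subseteq> zeta_lists n (Suc 0)"
    by (rule chain_common_denominator[OF assms assms])
  then show "z \<in> bar_boundaries (Suc 0) C"
    using zeta_bar_boundary[OF n(1), of z] n(2) * by (simp add: degree_one_value_def)
qed

text \<open>On bar generators this is the cochain c^j \<sigma>. It stays rational instead of being
  reduced modulo the integers, so that it can be compared with other rational cochains and
  multiplied by denominators.\<close>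

definition cap_value :: "nat \<Rightarrow> ('a list \<Rightarrow>\<^sub>0 int) \<Rightarrow> rat" where
  "cap_value j z = degree_one_value ((cap c ^^ j) z)"

lemma cap_value_Suc: "cap_value (Suc j) z = cap_value j (cap c z)"
  by (simp add: cap_value_def funpow_swap1)

lemma cap_value_add: "cap_value j (y + z) = cap_value j y + cap_value j z"
  by (induction j arbitrary: y z)
     (simp_all add: cap_value_Suc cap_add, simp add: cap_value_def degree_one_value_def pairing_add)

lemma cap_value_diff: "cap_value j (y - z) = cap_value j y - cap_value j z"
  using cap_value_add[of j "y - z" z] by simp

lemma cap_value_cmul: "cap_value j (frag_cmul a z) = of_int a * cap_value j z"
  by (induction j arbitrary: z)
     (simp_all add: cap_value_Suc cap_cmul, simp add: cap_value_def degree_one_value_def pairing_cmul)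

lemma bar_boundary_iff_cap_value:
  assumes "z \<in> bar_cycles (2 * j + 1) C"
  shows "z \<in> bar_boundaries (2 * j + 1) C \<longleftrightarrow> cap_value j z \<in> \<int>"
  using assms
proof (induction j arbitrary: z)
  case 0
  then show ?case
    using degree_one_boundary_iff[of z] by (simp add: cap_value_def in_bar_cycles_iff)
next
  case (Suc j)
  then have z: "z \<in> bar_cycles (Suc (Suc (Suc (2 * j)))) C" by simp
  have "cap c z \<in> bar_cycles (2 * j + 1) C"
    using cap_bar_cycles[OF z] by simp
  from Suc.IH[OF this] show ?case
    using cap_homology_inj[OF z] cap_bar_boundaries[of z "Suc (2 * j)"]
    by (auto simp: cap_value_Suc)
qed

lemma cap_value_surj:
  "\<exists>z\<in>bar_cycles (2 * j + 1) C. cap_value j z - q \<in> \<int>"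
proof (induction j)
  case 0
  have "\<sigma> (e q) - q \<in> \<int>" using e_eq_iff[of "\<sigma> (e q)" q] e_sigma[of "e q"] by simp
  then show ?case
    by (intro bexI[of _ "frag_of [e q]"])
       (simp_all add: cap_value_def degree_one_value_def in_bar_cycles_iff)
next
  case (Suc j)
  then obtain y where y: "y \<in> bar_cycles (Suc (2 * j)) C" "cap_value j y - q \<in> \<int>" by auto
  obtain z where z: "z \<in> bar_cycles (Suc (Suc (Suc (2 * j)))) C"
    "cap c z - y \<in> bar_boundaries (Suc (2 * j)) C"
    using cap_homology_surj[OF y(1)] by blast
  have "cap c z - y \<in> bar_cycles (2 * j + 1) C"
    using bar_boundaries_subset_bar_cycles[OF monoid_axioms] z(2) by auto
  then have "cap_value j (cap c z - y) \<in> \<int>"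
    using bar_boundary_iff_cap_value z(2) by simp
  from Ints_add[OF this y(2)] show ?case
    by (intro bexI[of _ z]) (use z(1) in \<open>simp_all add: cap_value_Suc cap_value_diff\<close>)
qed

end


section \<open>Homology groups as quotient groups\<close>

definition rat_add :: "rat monoid" where
  "rat_add = \<lparr>carrier = UNIV, mult = (+), one = 0\<rparr>"

lemma rat_mod_int_eq: "rat_mod_int = rat_add Mod \<int>"
  by (simp add: rat_mod_int_def rat_add_def)

lemma comm_group_rat_add: "comm_group rat_add"
proof (rule comm_groupI)
  fix x :: rat
  show "\<exists>y\<in>carrier rat_add. y \<otimes>\<^bsub>rat_add\<^esub> x = \<one>\<^bsub>rat_add\<^esub>"
    by (rule bexI[of _ "- x"]) (simp_all add: rat_add_def)
qed (auto simp: rat_add_def)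

lemma normal_Ints_rat_add: "\<int> \<lhd> rat_add"
proof -
  interpret comm_group rat_add by (rule comm_group_rat_add)
  have "inv\<^bsub>rat_add\<^esub> x = - x" for x
    by (rule inv_equality) (simp_all add: rat_add_def)
  then have "subgroup \<int> rat_add"
    by unfold_locales (auto simp: rat_add_def)
  then show ?thesis by (rule subgroup_imp_normal)
qed

lemma group_cycles:
  "group ((bar_chains n G)\<lparr>carrier := bar_cycles n G\<rparr>)"
proof (rule subgroup.subgroup_is_group)
  show "group (bar_chains n G)" by (simp add: bar_chains_def)
  then interpret group "bar_chains n G" .
  show "subgroup (bar_cycles n G) (bar_chains n G)"
    using keys_add[where 'a = "'a list" and 'b = int]
    by unfold_locales
       (auto simp: in_bar_cycles_iff bar_chains_def bar_boundary_add bar_boundary_minus intro: subsetD dest!: subsetD[OF keys_add])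
qed

lemma boundary_coset:
  "bar_boundaries n G #>\<^bsub>bar_chains n G\<^esub> z = {b + z |b. b \<in> bar_boundaries n G}"
  by (auto simp: r_coset_def bar_chains_def)

lemma boundary_coset_eq_iff:
  "bar_boundaries n G #>\<^bsub>bar_chains n G\<^esub> y = bar_boundaries n G #>\<^bsub>bar_chains n G\<^esub> z
    \<longleftrightarrow> y - z \<in> bar_boundaries n G"
proof
  assume "bar_boundaries n G #>\<^bsub>bar_chains n G\<^esub> y = bar_boundaries n G #>\<^bsub>bar_chains n G\<^esub> z"
  moreover have "y \<in> bar_boundaries n G #>\<^bsub>bar_chains n G\<^esub> y"
    using bar_boundaries_zero[of n G] by (force simp: boundary_coset)
  ultimately show "y - z \<in> bar_boundaries n G" by (auto simp: boundary_coset)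
next
  assume d: "y - z \<in> bar_boundaries n G"
  have "b + y = (b + (y - z)) + z" "b + z = (b - (y - z)) + y" for b by simp_all
  with bar_boundaries_add[OF _ d] bar_boundaries_diff[OF _ d]
  show "bar_boundaries n G #>\<^bsub>bar_chains n G\<^esub> y = bar_boundaries n G #>\<^bsub>bar_chains n G\<^esub> z"
    unfolding boundary_coset by blast
qed

lemma carrier_group_homology:
  "carrier (group_homology n G) = (\<lambda>z. bar_boundaries n G #>\<^bsub>bar_chains n G\<^esub> z) ` bar_cycles n G"
  by (simp add: group_homology_def carrier_FactGroup r_coset_def)

lemma one_group_homology: "\<one>\<^bsub>group_homology n G\<^esub> = bar_boundaries n G"
  by (simp add: group_homology_def)

text \<open>The first isomorphism theorem for \<open>cap_value j\<close> followed by reduction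
  modulo the integers; its kernel on cycles consists of the boundaries.\<close>

lemma (in rational_circle) group_homology_iso:
  "group_homology (2 * j + 1) C \<cong> rat_mod_int"
proof -
  let ?n = "2 * j + 1"
  let ?K = "(bar_chains ?n C)\<lparr>carrier := bar_cycles ?n C\<rparr>"
  have sub: "bar_boundaries ?n C \<subseteq> bar_cycles ?n C"
    by (rule bar_boundaries_subset_bar_cycles[OF monoid_axioms])
  interpret Q: normal \<int> rat_add by (rule normal_Ints_rat_add)
  define h where "h = (\<lambda>z. \<int> #>\<^bsub>rat_add\<^esub> cap_value j z)"
  have "cap_value j \<in> hom ?K rat_add"
    by (rule homI) (simp_all add: rat_add_def bar_chains_def cap_value_add)
  from hom_compose[OF this Q.r_coset_hom_Mod] have "h \<in> hom ?K rat_mod_int"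
    by (simp add: h_def comp_def rat_mod_int_eq)
  then interpret group_hom ?K rat_mod_int h
    using group_cycles Q.factorgroup_is_group
    by (simp add: group_hom_def group_hom_axioms_def rat_mod_int_eq)
  have "h z = \<one>\<^bsub>rat_mod_int\<^esub> \<longleftrightarrow> cap_value j z \<in> \<int>" for z
  proof -
    have "cap_value j z \<in> carrier rat_add" by (simp add: rat_add_def)
    then show ?thesis
      using Q.coset_join1[OF _ _ Q.subgroup_axioms] Q.coset_join2[OF _ Q.subgroup_axioms] Q.subset
      by (auto simp: h_def rat_mod_int_eq)
  qed
  then have "kernel ?K rat_mod_int h = bar_boundaries ?n C"
    using bar_boundary_iff_cap_value sub by (auto simp: kernel_def)
  moreover have "h ` carrier ?K = carrier rat_mod_int"
  proof
    show "h ` carrier ?K \<subseteq> carrier rat_mod_int" using hom_closed by blast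
    show "carrier rat_mod_int \<subseteq> h ` carrier ?K"
    proof
      fix A
      assume "A \<in> carrier rat_mod_int"
      then obtain q where q: "A = \<int> #>\<^bsub>rat_add\<^esub> q"
        by (auto simp: rat_mod_int_eq carrier_FactGroup)
      obtain z where z: "z \<in> bar_cycles ?n C" "cap_value j z - q \<in> \<int>"
        using cap_value_surj by blast
      have "cap_value j z \<in> \<int> #>\<^bsub>rat_add\<^esub> q"
        using z(2) by (force simp: r_coset_def rat_add_def)
      from Q.repr_independence[OF this _ Q.subgroup_axioms] have "A = h z"
        by (simp add: q h_def rat_add_def)
      then show "A \<in> h ` carrier ?K" using z(1) by simp
    qed
  qed
  ultimately show ?thesis
    using FactGroup_iso by (simp add: group_homology_def)
qed


section \<open>Extending the group\<close>

lemma bar_face_carrier_update [simp]: "bar_face (G\<lparr>carrier := K\<rparr>) i xs = bar_face G i xs"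
  by (simp add: bar_face_def)

lemma bar_boundary_carrier_update [simp]: "bar_boundary (G\<lparr>carrier := K\<rparr>) = bar_boundary G"
  by (simp add: bar_boundary_def cong: if_cong)

lemma homology_map_id_coset:
  "homology_map n G id (bar_boundaries n (G\<lparr>carrier := K\<rparr>) #>\<^bsub>bar_chains n (G\<lparr>carrier := K\<rparr>)\<^esub> z)
    = bar_boundaries n G #>\<^bsub>bar_chains n G\<^esub> z"
  if K: "K \<subseteq> carrier G"
proof -
  have sub: "bar_boundaries n (G\<lparr>carrier := K\<rparr>) \<subseteq> bar_boundaries n G"
    using K unfolding in_bar_boundaries_iff subset_iff tuples_def by auto
  have "homology_map n G id A = (\<Union>y\<in>A. bar_boundaries n G #>\<^bsub>bar_chains n G\<^esub> y)" for A
    by (simp add: homology_map_def flip: frag_expansion)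
  moreover have "bar_boundaries n G #>\<^bsub>bar_chains n G\<^esub> y = bar_boundaries n G #>\<^bsub>bar_chains n G\<^esub> z"
    if "y \<in> bar_boundaries n (G\<lparr>carrier := K\<rparr>) #>\<^bsub>bar_chains n (G\<lparr>carrier := K\<rparr>)\<^esub> z" for y
    unfolding boundary_coset_eq_iff using that sub by (auto simp: boundary_coset)
  moreover have "z \<in> bar_boundaries n (G\<lparr>carrier := K\<rparr>) #>\<^bsub>bar_chains n (G\<lparr>carrier := K\<rparr>)\<^esub> z"
    using bar_boundaries_zero[of n "G\<lparr>carrier := K\<rparr>"] by (force simp: boundary_coset)
  ultimately show ?thesis by blast
qed

text \<open>Cosets agree exactly when representatives differ by a boundary, so injectivity becomes a
  condition on single cycles; one direction takes 0 as the second representative. From here on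
  homology classes are replaced by cycles.\<close>

lemma homology_map_inj_iff:
  assumes "K \<subseteq> carrier G"
  shows "inj_on (homology_map n G id) (carrier (group_homology n (G\<lparr>carrier := K\<rparr>))) \<longleftrightarrow>
    bar_cycles n (G\<lparr>carrier := K\<rparr>) \<inter> bar_boundaries n G \<subseteq> bar_boundaries n (G\<lparr>carrier := K\<rparr>)"
    (is "?L \<longleftrightarrow> ?R")
proof -
  have "?L \<longleftrightarrow> (\<forall>y\<in>bar_cycles n (G\<lparr>carrier := K\<rparr>). \<forall>z\<in>bar_cycles n (G\<lparr>carrier := K\<rparr>).
      y - z \<in> bar_boundaries n G \<longrightarrow> y - z \<in> bar_boundaries n (G\<lparr>carrier := K\<rparr>))"
    by (simp add: carrier_group_homology inj_on_def homology_map_id_coset[OF assms] boundary_coset_eq_iff)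
  also have "\<dots> \<longleftrightarrow> ?R"
  proof
    assume L: "\<forall>y\<in>bar_cycles n (G\<lparr>carrier := K\<rparr>). \<forall>z\<in>bar_cycles n (G\<lparr>carrier := K\<rparr>).
      y - z \<in> bar_boundaries n G \<longrightarrow> y - z \<in> bar_boundaries n (G\<lparr>carrier := K\<rparr>)"
    have "0 \<in> bar_cycles n (G\<lparr>carrier := K\<rparr>)" by (simp add: in_bar_cycles_iff)
    with L show ?R by fastforce
  next
    assume ?R
    then show "\<forall>y\<in>bar_cycles n (G\<lparr>carrier := K\<rparr>). \<forall>z\<in>bar_cycles n (G\<lparr>carrier := K\<rparr>).
      y - z \<in> bar_boundaries n G \<longrightarrow> y - z \<in> bar_boundaries n (G\<lparr>carrier := K\<rparr>)"
      using bar_cycles_diff by blast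
  qed
  finally show ?thesis .
qed

lemma homology_map_nontrivial_iff:
  assumes "K \<subseteq> carrier G"
  shows "(\<exists>a\<in>carrier (group_homology n (G\<lparr>carrier := K\<rparr>)). homology_map n G id a \<noteq> \<one>\<^bsub>group_homology n G\<^esub>)
    \<longleftrightarrow> \<not> bar_cycles n (G\<lparr>carrier := K\<rparr>) \<subseteq> bar_boundaries n G"
proof -
  have "bar_boundaries n G #>\<^bsub>bar_chains n G\<^esub> z = bar_boundaries n G \<longleftrightarrow> z \<in> bar_boundaries n G" for z
    using boundary_coset_eq_iff[of n G z 0] by (simp add: boundary_coset)
  then show ?thesis
    by (auto simp: carrier_group_homology homology_map_id_coset[OF assms] one_group_homology)
qed

section \<open>Powers of a cocycle and their evaluation on chains\<close>

primrec cochain_power :: "('a list \<Rightarrow> 'r::comm_ring_1) \<Rightarrow> nat \<Rightarrow> 'a list \<Rightarrow> 'r" where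
  "cochain_power f 0 = (\<lambda>xs. if xs = [] then 1 else 0)"
| "cochain_power f (Suc k) = cup_cochain (2 * k) (cochain_power f k) f"

lemma cohomology_class_self: "f \<in> cohomology_class n G f"
proof -
  have "(\<lambda>_. 0) \<in> bar_coboundaries n G"
    by (auto simp: bar_coboundaries_def bar_coboundary_def bar_cochains_def split: nat.split
        intro!: image_eqI[of _ _ "\<lambda>_. 0"])
  then show ?thesis
    by (force simp: cohomology_class_def r_coset_def bar_cochains_def)
qed

text \<open>The product of classes is a union over all representatives, so it contains the product
  of any chosen ones.\<close>

lemma cochain_power_in_cup_power: "f \<in> A \<Longrightarrow> cochain_power f k \<in> cup_power G 2 A k"
proof (induction k)
  case 0
  then show ?case by (simp add: cohomology_class_self)
next
  case (Suc k)
  then show ?case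
    using cohomology_class_self[of "cochain_power f (Suc k)" "2 * k + 2" G]
    by (auto simp: cup_def)
qed

text \<open>The power grows by a factor at the end, whereas the cap product removes one at the
  front; associativity reconciles the two.\<close>

lemma cochain_power_Cons_Cons:
  "length ys = 2 * k \<Longrightarrow> cochain_power f (Suc k) (g # h # ys) = f [g, h] * cochain_power f k ys"
proof (induction k arbitrary: ys)
  case 0
  then show ?case by (simp add: cup_cochain_def)
next
  case (Suc k)
  have "cochain_power f (Suc (Suc k)) (g # h # ys)
      = cochain_power f (Suc k) (g # h # take (2 * k) ys) * f (drop (2 * k) ys)"
    by (subst cochain_power.simps(2)) (simp add: cup_cochain_def del: cochain_power.simps(2))
  also have "\<dots> = f [g, h] * (cochain_power f k (take (2 * k) ys) * f (drop (2 * k) ys))"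
    using Suc.IH[of "take (2 * k) ys"] Suc.prems by (simp add: mult.assoc del: cochain_power.simps(2))
  finally show ?case by (simp add: cup_cochain_def)
qed

lemma pairing_bar_boundary_frag_of:
  assumes "xs \<in> tuples (Suc n) G"
  shows "pairing b (bar_boundary G (frag_of xs)) = bar_coboundary n G b xs"
  using assms
  by (auto simp: bar_boundary_def bar_coboundary_def pairing_sum pairing_cmul pairing_add
      simp flip: minus_frag_cmul simp: pairing_diff tuples_def)

text \<open>The unit of the quotient group is the set of coboundaries itself, so a class equal to it
  consists of coboundaries. The primitive \<open>b\<close> is then evaluated on chains, where the
  coboundary is adjoint to the boundary.\<close>

lemma cup_power_trivialE:
  fixes f :: "'a list \<Rightarrow> 'r::comm_ring_1"
  assumes "cup_power G 2 A (Suc j) = \<one>\<^bsub>group_cohomology (2 * Suc j) G\<^esub>" "f \<in> A"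
  obtains b where "\<And>w :: 'a list \<Rightarrow>\<^sub>0 int. Poly_Mapping.keys w \<subseteq> tuples (2 * Suc j) G
    \<Longrightarrow> pairing b (bar_boundary G w) = pairing (cochain_power f (Suc j)) w"
proof -
  have "cochain_power f (Suc j) \<in> bar_coboundaries (2 * Suc j) G"
    using cochain_power_in_cup_power[OF assms(2), of "Suc j" G] assms(1)
    by (simp add: group_cohomology_def)
  then obtain b where b: "cochain_power f (Suc j) = bar_coboundary (Suc (2 * j)) G b"
    by (auto simp: bar_coboundaries_def)
  show thesis
  proof (rule that[of b])
    fix w :: "'a list \<Rightarrow>\<^sub>0 int"
    assume "Poly_Mapping.keys w \<subseteq> tuples (2 * Suc j) G"
    then show "pairing b (bar_boundary G w) = pairing (cochain_power f (Suc j)) w"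
    proof (induction w rule: frag_induction)
      case (one xs)
      then show ?case
        unfolding b using pairing_bar_boundary_frag_of[of xs "Suc (2 * j)" G b] by simp
    qed (simp_all add: bar_boundary_diff pairing_diff)
  qed
qed

text \<open>The situation of the theorem without circles: an integral cocycle on \<open>G\<close>
  that acquires a rational primitive on a copy \<open>K\<close> of Q/Z.\<close>

locale circle_extension = two_cocycle G c for G (structure) and c +
  fixes K :: "'a set" and e :: "rat \<Rightarrow> 'a" and \<sigma> :: "'a \<Rightarrow> rat"
  assumes sub: "K \<subseteq> carrier G" and rational_circle: "rational_circle (G\<lparr>carrier := K\<rparr>) e \<sigma> c"
begin

abbreviation "C \<equiv> G\<lparr>carrier := K\<rparr>"

sublocale C: rational_circle C e \<sigma> c
  by (rule rational_circle)

lemma injective_step: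
  assumes "bar_cycles (Suc m) C \<inter> bar_boundaries (Suc m) G \<subseteq> bar_boundaries (Suc m) C"
  shows "bar_cycles (Suc (Suc (Suc m))) C \<inter> bar_boundaries (Suc (Suc (Suc m))) G
    \<subseteq> bar_boundaries (Suc (Suc (Suc m))) C"
proof
  fix z
  assume "z \<in> bar_cycles (Suc (Suc (Suc m))) C \<inter> bar_boundaries (Suc (Suc (Suc m))) G"
  then have z: "z \<in> bar_cycles (Suc (Suc (Suc m))) C" "z \<in> bar_boundaries (Suc (Suc (Suc m))) G"
    by auto
  have "cap c z \<in> bar_boundaries (Suc m) C"
    using C.cap_bar_cycles[OF z(1)] cap_bar_boundaries[OF z(2)] assms by auto
  with z(1) show "z \<in> bar_boundaries (Suc (Suc (Suc m))) C" by (rule C.cap_homology_inj)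
qed

lemma bar_boundaries_mono: "bar_boundaries n C \<subseteq> bar_boundaries n G"
  using sub unfolding in_bar_boundaries_iff subset_iff tuples_def by auto

text \<open>Here surjectivity of the cap product on \<open>C\<close> is used: a class surviving in
  \<open>G\<close> is the cap product of some class, and that class cannot die in \<open>G\<close>
  either. The injective case uses injectivity on \<open>C\<close> instead.\<close>

lemma nontrivial_step:
  assumes "\<not> bar_cycles (Suc m) C \<subseteq> bar_boundaries (Suc m) G"
  shows "\<not> bar_cycles (Suc (Suc (Suc m))) C \<subseteq> bar_boundaries (Suc (Suc (Suc m))) G"
proof
  assume *: "bar_cycles (Suc (Suc (Suc m))) C \<subseteq> bar_boundaries (Suc (Suc (Suc m))) G"
  obtain y where y: "y \<in> bar_cycles (Suc m) C" "y \<notin> bar_boundaries (Suc m) G"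
    using assms by blast
  obtain z where z: "z \<in> bar_cycles (Suc (Suc (Suc m))) C" "cap c z - y \<in> bar_boundaries (Suc m) C"
    using C.cap_homology_surj[OF y(1)] by blast
  have "cap c z \<in> bar_boundaries (Suc m) G"
    using * z(1) by (intro cap_bar_boundaries) auto
  moreover have "cap c z - y \<in> bar_boundaries (Suc m) G" using z(2) bar_boundaries_mono by blast
  ultimately have "cap c z - (cap c z - y) \<in> bar_boundaries (Suc m) G" by (rule bar_boundaries_diff)
  with y(2) show False by simp
qed

text \<open>Adjointness of cup and cap product, with the factor split off at the front.\<close>

lemma pairing_cochain_power:
  assumes f: "\<And>g h. g \<in> carrier G \<Longrightarrow> h \<in> carrier G \<Longrightarrow> f [g, h] = of_int (c g h)"
    and "Poly_Mapping.keys w \<subseteq> tuples (2 * Suc k) G"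
  shows "pairing (cochain_power f (Suc k)) w = pairing (cochain_power f k) (cap c w)"
  using assms(2)
proof (induction w rule: frag_induction)
  case (one xs)
  then obtain g h ys where xs: "xs = g # h # ys" "g \<in> carrier G" "h \<in> carrier G" "ys \<in> tuples (2 * k) G"
    by (auto simp: tuples_Suc)
  then have "length ys = 2 * k" by (simp add: tuples_def)
  then show ?case
    by (simp add: xs cochain_power_Cons_Cons f pairing_cmul del: cochain_power.simps)
qed (simp_all add: pairing_diff cap_diff del: cochain_power.simps)

lemma pairing_cochain_power_Ints:
  assumes f: "\<And>g h. g \<in> carrier G \<Longrightarrow> h \<in> carrier G \<Longrightarrow> f [g, h] = of_int (c g h)"
    and "Poly_Mapping.keys w \<subseteq> tuples (2 * k) G"
  shows "pairing (cochain_power f k) w \<in> \<int>"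
  using assms(2)
proof (induction k arbitrary: w)
  case 0
  then show ?case by (intro pairing_Ints[OF 0]) auto
next
  case (Suc k)
  have "Poly_Mapping.keys (cap c w) \<subseteq> tuples (2 * k) G"
    using Suc.prems by (intro cap_chain) simp
  from Suc.IH[OF this] show ?case
    by (simp add: pairing_cochain_power[OF f Suc.prems] del: cochain_power.simps)
qed

text \<open>\<open>C.cap_value j\<close> is a rational primitive on \<open>C\<close> of the power of
  the cocycle. In degree two this is \<delta>\<sigma> = c, and the cap product, commuting with the
  boundary, carries it to higher degrees.\<close>

lemma cap_value_bar_boundary:
  fixes f :: "'a list \<Rightarrow> rat"
  assumes f: "\<And>g h. g \<in> carrier G \<Longrightarrow> h \<in> carrier G \<Longrightarrow> f [g, h] = of_int (c g h)"
    and "Poly_Mapping.keys w \<subseteq> tuples (2 * Suc j) C"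
  shows "pairing (cochain_power f (Suc j)) w = C.cap_value j (bar_boundary G w)"
  using assms(2)
proof (induction j arbitrary: w)
  case 0
  have "pairing (cochain_power f (Suc 0)) w = pairing (\<lambda>xs. of_int (c (xs ! 0) (xs ! 1))) w"
  proof (rule pairing_cong[OF 0])
    fix xs
    assume "xs \<in> tuples (2 * Suc 0) C"
    then have "xs \<in> tuples (Suc (Suc 0)) C" by (simp add: numeral_2_eq_2)
    then obtain g h where "xs = [g, h]" "g \<in> carrier G" "h \<in> carrier G"
      using sub by (auto simp: tuples_Suc)
    then show "cochain_power f (Suc 0) xs = of_int (c (xs ! 0) (xs ! 1))"
      by (simp add: cochain_power_Cons_Cons f del: cochain_power.simps(2))
  qed
  then show ?case
    using C.degree_one_value_bar_boundary[of w] 0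
    by (simp add: C.cap_value_def numeral_2_eq_2 del: cochain_power.simps)
next
  case (Suc j)
  have w: "Poly_Mapping.keys w \<subseteq> tuples (2 * Suc (Suc j)) G"
    using Suc.prems sub unfolding tuples_def by fastforce
  have "Poly_Mapping.keys (cap c w) \<subseteq> tuples (2 * Suc j) C"
    using Suc.prems by (intro cap_chain) simp
  from Suc.IH[OF this] have "pairing (cochain_power f (Suc (Suc j))) w
      = C.cap_value j (bar_boundary G (cap c w))"
    by (simp only: pairing_cochain_power[OF f w])
  also have "bar_boundary G (cap c w) = cap c (bar_boundary G w)"
    by (rule bar_boundary_cap[OF w]) simp
  finally show ?case by (simp only: C.cap_value_Suc)
qed

text \<open>The primitive \<open>b\<close> on \<open>G\<close> and the primitive
  \<open>C.cap_value j\<close> on \<open>C\<close> agree on boundaries of \<open>C\<close>, hence on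
  every cycle with a nonzero multiple that bounds in \<open>C\<close>. If the cycle bounds in
  \<open>G\<close>, then \<open>b\<close> is integral on it, and so is
  \<open>C.cap_value j\<close>.\<close>

lemma injective_if_power_trivial:
  fixes f :: "'a list \<Rightarrow> rat"
  assumes f: "\<And>g h. g \<in> carrier G \<Longrightarrow> h \<in> carrier G \<Longrightarrow> f [g, h] = of_int (c g h)"
    and "f \<in> A" and triv: "cup_power G 2 A (Suc j) = \<one>\<^bsub>group_cohomology (2 * Suc j) G\<^esub>"
  shows "bar_cycles (2 * j + 1) C \<inter> bar_boundaries (2 * j + 1) G \<subseteq> bar_boundaries (2 * j + 1) C"
proof
  fix z
  assume "z \<in> bar_cycles (2 * j + 1) C \<inter> bar_boundaries (2 * j + 1) G"
  then have z: "z \<in> bar_cycles (2 * j + 1) C" "z \<in> bar_boundaries (2 * j + 1) G" by auto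
  obtain b where b: "\<And>w. Poly_Mapping.keys w \<subseteq> tuples (2 * Suc j) G
      \<Longrightarrow> pairing b (bar_boundary G w) = pairing (cochain_power f (Suc j)) w"
    using cup_power_trivialE[OF triv \<open>f \<in> A\<close>] by blast
  obtain w where w: "Poly_Mapping.keys w \<subseteq> tuples (2 * Suc j) G" "z = bar_boundary G w"
    using z(2) by (auto simp: in_bar_boundaries_iff)
  have bz: "pairing b z \<in> \<int>"
    unfolding w(2) b[OF w(1)] by (rule pairing_cochain_power_Ints[OF f w(1)])
  \<comment> \<open>The denominator \<open>d\<close> makes the value of the multiple
    \<open>d z\<close> integral, so this multiple bounds in \<open>C\<close>; dividing by
    \<open>d\<close> afterwards is legitimate over the rationals.\<close>
  obtain a d where ad: "C.cap_value j z = of_int a / of_int d" "d > 0"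
    using quotient_of_div[of "C.cap_value j z"] quotient_of_denom_pos'[of "C.cap_value j z"]
    by (metis prod.collapse)
  have "C.cap_value j (frag_cmul d z) = of_int a"
    using ad by (simp add: C.cap_value_cmul)
  then have "frag_cmul d z \<in> bar_boundaries (2 * j + 1) C"
    using C.bar_boundary_iff_cap_value[OF bar_cycles_cmul[OF z(1)], of d] by simp
  then obtain v where v: "Poly_Mapping.keys v \<subseteq> tuples (2 * Suc j) C" "frag_cmul d z = bar_boundary G v"
    by (auto simp: in_bar_boundaries_iff)
  have vG: "Poly_Mapping.keys v \<subseteq> tuples (2 * Suc j) G"
    using v(1) sub unfolding tuples_def by fastforce
  have "of_int d * pairing b z = of_int d * C.cap_value j z"
    using b[OF vG] cap_value_bar_boundary[OF f v(1)]
    by (simp add: pairing_cmul C.cap_value_cmul flip: v(2))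
  with ad(2) bz have "C.cap_value j z \<in> \<int>" by simp
  then show "z \<in> bar_boundaries (2 * j + 1) C"
    using C.bar_boundary_iff_cap_value[OF z(1)] by simp
qed

end


section \<open>Lifting circle diffeomorphisms to the line\<close>

lemma circle_of_eq_iff: "circle_of x = circle_of y \<longleftrightarrow> x - y \<in> \<int>"
  by (rule circle.abs_eq_iff)

lemma circle_of_rep_circle [simp]: "circle_of (rep_circle z) = z"
  by (rule Quotient3_abs_rep[OF Quotient3_circle])

lemma circle_cases: obtains x where "z = circle_of x"
  using circle_of_rep_circle by metis

lemma Ints_valued_constant:
  fixes D :: "real \<Rightarrow> real"
  assumes "connected S" "continuous_on S D" "\<And>x. x \<in> S \<Longrightarrow> D x \<in> \<int>"
  obtains m :: int where "\<And>x. x \<in> S \<Longrightarrow> D x = of_int m"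
proof -
  have "D constant_on S"
  proof (rule continuous_discrete_range_constant[OF assms(1,2)])
    fix x assume "x \<in> S"
    show "\<exists>e>0. \<forall>y. y \<in> S \<and> D y \<noteq> D x \<longrightarrow> e \<le> norm (D y - D x)"
    proof (intro exI[of _ 1] conjI allI impI)
      fix y assume "y \<in> S \<and> D y \<noteq> D x"
      then have "D y - D x \<in> \<int>" "D y - D x \<noteq> 0" using assms(3) \<open>x \<in> S\<close> by auto
      then show "1 \<le> norm (D y - D x)" by (simp add: Ints_nonzero_abs_ge1)
    qed simp
  qed
  then obtain a where a: "\<And>x. x \<in> S \<Longrightarrow> D x = a" by (auto simp: constant_on_def)
  show thesis
  proof (cases "S = {}")
    case False
    then obtain m where "a = of_int m" using a assms(3) by (metis Ints_cases all_not_in_conv)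
    then show ?thesis using that a by blast
  qed (use that[of 0] in auto)
qed

lemma lifts_differ_by_Ints:
  fixes F F' :: "real \<Rightarrow> real"
  assumes "continuous_on UNIV F" "continuous_on UNIV F'" "\<And>x. circle_of (F x) = circle_of (F' x)"
  obtains m :: int where "\<And>x. F x = F' x + of_int m"
proof -
  obtain m where "\<And>x. x \<in> UNIV \<Longrightarrow> F x - F' x = of_int m"
    by (rule Ints_valued_constant[of UNIV "\<lambda>x. F x - F' x"])
       (use assms in \<open>auto intro!: continuous_intros simp: circle_of_eq_iff\<close>)
  then show thesis using that[of m] by (simp add: algebra_simps)
qed

lemma smooth_on_continuous_on: "smooth_on U F \<Longrightarrow> continuous_on U F"
  unfolding smooth_on_def
  by (intro continuous_at_imp_continuous_on ballI differentiable_imp_continuous_within)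
     (metis funpow_0)

text \<open>An added constant affects only the derivative of order 0. On an open set, equality of
  functions is equality of germs and passes to derivatives.\<close>

lemma smooth_on_add_const:
  assumes "smooth_on V F'" "open V" "\<And>x. x \<in> V \<Longrightarrow> F x = F' x + a"
  shows "smooth_on V F"
proof -
  have eq: "\<forall>x\<in>V. (deriv ^^ n) F x = (deriv ^^ n) F' x + (if n = 0 then a else 0)" for n :: nat
  proof (induction n)
    case (Suc n)
    let ?a = "if n = 0 then a else 0"
    show ?case
    proof
      fix x assume x: "x \<in> V"
      have "(deriv ^^ n) F' field_differentiable (at x)"
        using assms(1) x by (simp add: smooth_on_def real_differentiable_def field_differentiable_def)
      then have "((\<lambda>y. (deriv ^^ n) F' y + ?a) has_field_derivative deriv ((deriv ^^ n) F') x) (at x)"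
        by (auto intro!: derivative_eq_intros simp: DERIV_deriv_iff_field_differentiable)
      then have "deriv (\<lambda>y. (deriv ^^ n) F' y + ?a) x = deriv ((deriv ^^ n) F') x"
        by (rule DERIV_imp_deriv)
      moreover have "\<forall>\<^sub>F y in nhds x. (deriv ^^ n) F y = (deriv ^^ n) F' y + ?a"
        using Suc x assms(2) by (auto simp: eventually_nhds)
      then have "deriv ((deriv ^^ n) F) x = deriv (\<lambda>y. (deriv ^^ n) F' y + ?a) x"
        by (rule deriv_cong_ev) simp
      ultimately show "(deriv ^^ Suc n) F x = (deriv ^^ Suc n) F' x + (if Suc n = 0 then a else 0)"
        by simp
    qed
  qed (use assms(3) in simp)
  show ?thesis
    unfolding smooth_on_def
  proof (intro allI ballI)
    fix n :: nat and x assume x: "x \<in> V"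
    let ?a = "if n = 0 then a else 0"
    have "(\<lambda>y. (deriv ^^ n) F' y + ?a) differentiable (at x)"
      using assms(1) x by (intro differentiable_add) (auto simp: smooth_on_def)
    then show "(deriv ^^ n) F differentiable (at x)"
      unfolding differentiable_def
      using has_derivative_transform_within_open[OF _ assms(2) x] eq by (metis (no_types, lifting))
  qed
qed

lemma cis_2pi_eq_iff: "cis (2 * pi * x) = cis (2 * pi * y) \<longleftrightarrow> x - y \<in> \<int>"
proof -
  have "cis (2 * pi * x) = cis (2 * pi * y) \<longleftrightarrow> cis (2 * pi * x) / cis (2 * pi * y) = 1"
    by simp
  also have "\<dots> \<longleftrightarrow> cis (2 * pi * (x - y)) = 1"
    by (simp add: cis_divide right_diff_distrib)
  also have "\<dots> \<longleftrightarrow> exp (\<i> * complex_of_real (2 * pi * (x - y))) = 1"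
    by (simp only: cis_conv_exp)
  also have "\<dots> \<longleftrightarrow> (\<exists>n::int. 2 * pi * (x - y) = of_int (2 * n) * pi)"
    by (simp add: exp_eq_1)
  also have "\<dots> \<longleftrightarrow> (\<exists>n::int. x - y = of_int n)"
  proof -
    have "2 * pi * (x - y) = of_int (2 * n) * pi \<longleftrightarrow> x - y = of_int n" for n
    proof -
      have "2 * pi * (x - y) = of_int (2 * n) * pi \<longleftrightarrow> (2 * pi) * (x - y) = (2 * pi) * of_int n"
        by (simp add: mult_ac)
      then show ?thesis by (subst (asm) mult_cancel_left) simp
    qed
    then show ?thesis by simp
  qed
  finally show ?thesis by (auto simp: Ints_def)
qed

text \<open>Seen in the complex plane, \<open>f\<close> becomes a continuous nowhere zero function
  on the line, which has a continuous logarithm as the line is contractible; its imaginary part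
  gives the lift. Smoothness is local, and locally the lift differs from a smooth one by a constant
  integer.\<close>

lemma smooth_lift_exists:
  assumes "circle_smooth f"
  obtains F where "smooth_on UNIV F" "\<And>x. f (circle_of x) = circle_of (F x)"
proof -
  \<comment> \<open>\<open>rep_circle\<close> picks representatives without any continuity, but the
    exponential does not see the integer jumps.\<close>
  define g where "g = (\<lambda>y. cis (2 * pi * rep_circle (f (circle_of y))))"
  have g: "g y = cis (2 * pi * a) \<longleftrightarrow> f (circle_of y) = circle_of a" for y a
    unfolding g_def cis_2pi_eq_iff circle_of_eq_iff[symmetric] by simp
  have "isCont g x" for x
  proof -
    obtain U F where U: "x \<in> U" "smooth_local_lift f U F"
      using assms unfolding circle_smooth_def by blast
    then have "open U" "smooth_on U F" and *: "\<And>y. y \<in> U \<Longrightarrow> f (circle_of y) = circle_of (F y)"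
      by (auto simp: smooth_local_lift_def)
    then have "isCont F x"
      using smooth_on_continuous_on U(1) continuous_on_eq_continuous_at by blast
    then have "isCont (\<lambda>y. cis (2 * pi * F y)) x"
      unfolding cis_conv_exp by (intro continuous_intros)
    moreover have "\<forall>\<^sub>F y in nhds x. g y = cis (2 * pi * F y)"
      using \<open>open U\<close> U(1) * g by (auto simp: eventually_nhds)
    ultimately show ?thesis by (subst isCont_cong)
  qed
  then have "continuous_on UNIV g" by (simp add: continuous_at_imp_continuous_on)
  moreover have "g y \<noteq> 0" for y by (simp add: g_def)
  ultimately obtain h where h: "continuous_on UNIV h" "\<And>y. g y = exp (h y)"
    using continuous_logarithm_on_contractible[of UNIV g] convex_imp_contractible[OF convex_UNIV]
    by (metis UNIV_I)
  define F where "F = (\<lambda>y. Im (h y) / (2 * pi))"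
  have contF: "continuous_on UNIV F" unfolding F_def by (intro continuous_intros h) auto
  have lift: "f (circle_of y) = circle_of (F y)" for y
  proof -
    have "norm (g y) = 1" by (simp add: g_def)
    then have "Re (h y) = 0" by (simp add: h(2))
    then have "g y = cis (2 * pi * F y)" by (simp add: h(2) exp_eq_polar F_def)
    then show ?thesis by (simp add: g)
  qed
  have "\<exists>V. open V \<and> x \<in> V \<and> smooth_on V F" for x
  proof -
    obtain U F' where U: "x \<in> U" "smooth_local_lift f U F'"
      using assms unfolding circle_smooth_def by blast
    then have "open U" "smooth_on U F'" and *: "\<And>y. y \<in> U \<Longrightarrow> f (circle_of y) = circle_of (F' y)"
      by (auto simp: smooth_local_lift_def)
    \<comment> \<open>A ball, because a connected domain is needed for the integer difference of the
      two lifts to be constant.\<close>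
    obtain r where r: "r > 0" "ball x r \<subseteq> U" using \<open>open U\<close> U(1) openE by blast
    have sm: "smooth_on (ball x r) F'" using \<open>smooth_on U F'\<close> r(2) by (auto simp: smooth_on_def)
    obtain m where m: "\<And>y. y \<in> ball x r \<Longrightarrow> F y - F' y = of_int m"
    proof (rule Ints_valued_constant[of "ball x r" "\<lambda>y. F y - F' y"])
      show "continuous_on (ball x r) (\<lambda>y. F y - F' y)"
        using contF smooth_on_continuous_on[OF sm] continuous_on_subset by (intro continuous_on_diff) auto
      show "F y - F' y \<in> \<int>" if "y \<in> ball x r" for y
        using lift[of y] *[of y] that r(2) by (auto simp flip: circle_of_eq_iff)
    qed auto
    have "smooth_on (ball x r) F"
      by (rule smooth_on_add_const[OF sm, of _ "of_int m"]) (use m in \<open>auto simp: algebra_simps\<close>)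
    then show ?thesis using r(1) by (intro exI[of _ "ball x r"]) auto
  qed
  then have "smooth_on UNIV F" unfolding smooth_on_def by blast
  with lift that show thesis by blast
qed

lemma continuous_lift_shift:
  assumes "continuous_on UNIV F" "\<And>x. f (circle_of x) = circle_of (F x)"
  obtains d :: int where "\<And>x. F (x + 1) = F x + of_int d"
proof (rule lifts_differ_by_Ints[of "\<lambda>x. F (x + 1)" F])
  show "continuous_on UNIV (\<lambda>x. F (x + 1))"
    by (intro continuous_on_compose2[OF assms(1)] continuous_intros) auto
  show "circle_of (F (x + 1)) = circle_of (F x)" for x
    unfolding assms(2)[symmetric] by (rule arg_cong[of _ _ f]) (simp add: circle_of_eq_iff)
qed (use assms(1) that in auto)

lemma shift_of_int:
  fixes F :: "real \<Rightarrow> real"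
  assumes "\<And>x. F (x + 1) = F x + a"
  shows "F (x + of_int n) = F x + a * of_int n"
proof (induction n rule: int_induct[where k = 0])
  case (step1 i)
  then show ?case using assms[of "x + of_int i"] by (simp add: algebra_simps)
next
  case (step2 i)
  then show ?case using assms[of "x + of_int i - 1"] by (simp add: algebra_simps)
qed simp

lemma descend_eqI:
  assumes "\<And>x. f (circle_of x) = circle_of (F x)"
  shows "descend F = f"
  unfolding descend_def
proof (rule the_equality)
  fix g
  assume "\<forall>x. g (circle_of x) = circle_of (F x)"
  then show "g = f" using assms by (metis circle_cases ext)
qed (use assms in simp)

lemma Diff_line_periodic_iff:
  "F \<in> carrier Diff_line_periodic \<longleftrightarrow> F \<in> Diff_line \<and> (\<forall>x. F (x + 1) = F x + 1)"
  by (auto simp: Diff_line_periodic_def translation_def fun_eq_iff)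

lemma descend_circle_of:
  assumes "F \<in> carrier Diff_line_periodic"
  shows "descend F (circle_of x) = circle_of (F x)"
proof -
  have F: "F (y + of_int n) = F y + of_int n" for y n
    using shift_of_int[of F 1] assms by (simp add: Diff_line_periodic_iff)
  have "circle_of (F (rep_circle (circle_of y))) = circle_of (F y)" for y
  proof -
    have "rep_circle (circle_of y) - y \<in> \<int>" by (simp flip: circle_of_eq_iff)
    then obtain n where "rep_circle (circle_of y) - y = of_int n" by (auto simp: Ints_def)
    then have "rep_circle (circle_of y) = y + of_int n" by simp
    then show ?thesis by (simp add: F circle_of_eq_iff)
  qed
  then have "descend F = (\<lambda>z. circle_of (F (rep_circle z)))"
    by (intro descend_eqI)
  then show ?thesis using \<open>\<And>y. circle_of (F (rep_circle (circle_of y))) = circle_of (F y)\<close> by simp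
qed

text \<open>The inverse of \<open>f\<close> is lifted as well. Both compositions of the lifts lift
  the identity, hence are integer translations, which yields bijectivity and a smooth inverse. The
  degrees of the lifts multiply to 1, and orientation excludes -1.\<close>

lemma Diff_line_periodic_lift_exists:
  assumes "f \<in> carrier Diff_circle"
  obtains F where "F \<in> carrier Diff_line_periodic" "descend F = f"
proof -
  have f: "bij f" "circle_smooth f" "circle_smooth (inv_into UNIV f)" "circle_orientation_preserving f"
    using assms by (auto simp: Diff_circle_def)
  obtain F where F: "smooth_on UNIV F" "\<And>x. f (circle_of x) = circle_of (F x)"
    using smooth_lift_exists[OF f(2)] by blast
  obtain G where G: "smooth_on UNIV G" "\<And>x. inv_into UNIV f (circle_of x) = circle_of (G x)"
    using smooth_lift_exists[OF f(3)] by blast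
  note contF = smooth_on_continuous_on[OF F(1)] and contG = smooth_on_continuous_on[OF G(1)]
  have pos: "deriv F x > 0" for x
    using f(4) F unfolding circle_orientation_preserving_def smooth_local_lift_def by blast
  have diffF: "(F has_field_derivative deriv F x) (at x)" for x
    using F(1) unfolding smooth_on_def DERIV_deriv_iff_real_differentiable
    by (metis UNIV_I funpow_0)
  have less: "F x < F y" if "x < y" for x y
    using DERIV_pos_imp_increasing[OF that] diffF pos by blast
  obtain m where m: "\<And>x. G (F x) = x + of_int m"
  proof (rule lifts_differ_by_Ints[of "\<lambda>x. G (F x)" "\<lambda>x. x"])
    show "continuous_on UNIV (\<lambda>x. G (F x))"
      by (rule continuous_on_compose2[OF contG contF]) auto
    show "circle_of (G (F x)) = circle_of x" for x
      by (simp flip: F(2) G(2) add: bij_is_inj[OF f(1)])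
  qed (auto intro: continuous_intros)
  obtain m' where m': "\<And>x. F (G x) = x + of_int m'"
  proof (rule lifts_differ_by_Ints[of "\<lambda>x. F (G x)" "\<lambda>x. x"])
    show "continuous_on UNIV (\<lambda>x. F (G x))"
      by (rule continuous_on_compose2[OF contF contG]) auto
    show "circle_of (F (G x)) = circle_of x" for x
      by (simp flip: F(2) G(2) add: surj_f_inv_f[OF bij_is_surj[OF f(1)]])
  qed (auto intro: continuous_intros)
  have bijF: "bij F"
  proof (rule bijI)
    show "inj F" using less by (metis injI linorder_neqE_linordered_idom less_irrefl)
    show "surj F"
      by (rule surjI[of _ "\<lambda>x. G (x - of_int m')"]) (simp add: m')
  qed
  have "inv_into UNIV F x = G x + (- of_int m)" for x
    using m[of "inv_into UNIV F x"] by (simp add: surj_f_inv_f[OF bij_is_surj[OF bijF]])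
  then have smooth_inv: "smooth_on UNIV (inv_into UNIV F)"
    using smooth_on_add_const[OF G(1)] by simp
  obtain d where d: "\<And>x. F (x + 1) = F x + of_int d"
    using continuous_lift_shift[OF contF F(2)] by blast
  obtain d' where d': "\<And>x. G (x + 1) = G x + of_int d'"
    using continuous_lift_shift[OF contG G(2)] by blast
  \<comment> \<open>The argument is \<open>F 1\<close>, so \<open>m\<close> gives a second value for
    the left side; comparing the two yields the product of the degrees.\<close>
  have "G (F 0 + of_int d) = G (F 0) + of_int d' * of_int d"
    using d' by (rule shift_of_int[of G])
  then have "(of_int (d' * d) :: real) = of_int 1"
    using m[of 0] m[of 1] d[of 0] by simp
  then have "d' * d = 1" by (simp only: of_int_eq_iff)
  moreover have "d > 0" using less[of 0 1] d[of 0] by simp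
  ultimately have "d = 1" by (metis zmult_eq_1_iff mult.commute less_asym' neg_0_less_iff_less zero_less_one)
  with d have "F \<in> carrier Diff_line_periodic"
    using F(1) bijF smooth_inv pos by (simp add: Diff_line_periodic_iff Diff_line_def)
  moreover have "descend F = f" using F(2) by (rule descend_eqI)
  ultimately show thesis using that by blast
qed

text \<open>Literally the choice made in the definition of the Euler class, so its cocycle
  represents that class and no two sections have to be compared.\<close>

definition circle_section :: "(circle \<Rightarrow> circle) \<Rightarrow> (real \<Rightarrow> real)" where
  "circle_section = (SOME s. is_section Diff_line_periodic descend Diff_circle s)"

lemma is_section_circle_section: "is_section Diff_line_periodic descend Diff_circle circle_section"
proof -
  have "\<exists>F. F \<in> carrier Diff_line_periodic \<and> descend F = f" if "f \<in> carrier Diff_circle" for f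
    using Diff_line_periodic_lift_exists[OF that] by blast
  then have "is_section Diff_line_periodic descend Diff_circle
      (\<lambda>f. SOME F. F \<in> carrier Diff_line_periodic \<and> descend F = f)"
    unfolding is_section_def by (metis (mono_tags, lifting) someI_ex)
  then show ?thesis unfolding circle_section_def by (rule someI[of "is_section _ _ _"])
qed

lemma circle_section:
  assumes "f \<in> carrier Diff_circle"
  shows "continuous_on UNIV (circle_section f)"
    "circle_section f (x + of_int n) = circle_section f x + of_int n"
    "circle_of (circle_section f x) = f (circle_of x)"
proof -
  have s: "circle_section f \<in> carrier Diff_line_periodic" "descend (circle_section f) = f"
    using is_section_circle_section assms by (auto simp: is_section_def)
  then show "continuous_on UNIV (circle_section f)"
    by (intro smooth_on_continuous_on) (simp add: Diff_line_periodic_iff Diff_line_def)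
  show "circle_section f (x + of_int n) = circle_section f x + of_int n"
    using shift_of_int[of "circle_section f" 1] s by (simp add: Diff_line_periodic_iff)
  show "circle_of (circle_section f x) = f (circle_of x)"
    using descend_circle_of[OF s(1)] s(2) by simp
qed

definition euler_cocycle :: "(circle \<Rightarrow> circle) \<Rightarrow> (circle \<Rightarrow> circle) \<Rightarrow> int" where
  "euler_cocycle f g = extension_cocycle Diff_line_periodic translation Diff_circle circle_section [f, g]"

text \<open>Both sides lift \<open>f \<circ> g\<close>, so they differ by a single integer. That
  \<open>f \<circ> g\<close> is a diffeomorphism is a premise here; it will come from the closure of
  \<Gamma> under composition.\<close>

lemma euler_cocycle:
  assumes "f \<in> carrier Diff_circle" "g \<in> carrier Diff_circle" "f \<circ> g \<in> carrier Diff_circle"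
  shows "circle_section f (circle_section g x) = circle_section (f \<circ> g) x + of_int (euler_cocycle f g)"
proof -
  note s = circle_section
  obtain n where n: "\<And>x. circle_section f (circle_section g x) = circle_section (f \<circ> g) x + of_int n"
  proof (rule lifts_differ_by_Ints[of "\<lambda>x. circle_section f (circle_section g x)" "circle_section (f \<circ> g)"])
    show "continuous_on UNIV (\<lambda>x. circle_section f (circle_section g x))"
      by (rule continuous_on_compose2[OF s(1) s(1)]) (use assms in auto)
    show "circle_of (circle_section f (circle_section g x)) = circle_of (circle_section (f \<circ> g) x)" for x
      using assms by (simp add: s(3))
  qed (use s(1) assms in auto)
  have "euler_cocycle f g = (THE n. circle_section f \<circ> circle_section g = translation n \<circ> circle_section (f \<circ> g))"
    using assms
    by (simp add: euler_cocycle_def extension_cocycle_def tuples_def Diff_line_periodic_def)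
       (simp add: Diff_circle_def)
  also have "\<dots> = n"
    by (rule the_equality) (use n in \<open>auto simp: translation_def fun_eq_iff\<close>)
  finally show ?thesis using n by simp
qed

section \<open>Rotations and the translation numbers of their lifts\<close>

lemma rotation_circle_of [simp]: "rotation a (circle_of x) = circle_of (x + a)"
  by (rule rotation.abs_eq)

lemma rotation_add: "rotation a \<circ> rotation b = rotation (a + b)"
proof
  fix z
  show "(rotation a \<circ> rotation b) z = rotation (a + b) z"
    by (cases z rule: circle_cases) (simp add: add_ac)
qed

lemma rotation_eq_iff: "rotation a = rotation b \<longleftrightarrow> a - b \<in> \<int>"
proof
  assume "rotation a = rotation b"
  from fun_cong[OF this, of "circle_of 0"] show "a - b \<in> \<int>" by (simp add: circle_of_eq_iff)
next
  assume "a - b \<in> \<int>"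
  then have "rotation a (circle_of x) = rotation b (circle_of x)" for x by (simp add: circle_of_eq_iff)
  then show "rotation a = rotation b" by (metis circle_cases ext)
qed

lemma rotation_0: "rotation 0 = id"
proof
  show "rotation 0 z = id z" for z by (cases z rule: circle_cases) simp
qed

lemma rotation_power: "rotation a [^]\<^bsub>Diff_circle\<^esub> n = rotation (of_nat n * a)" for n :: nat
  by (induction n) (simp_all add: nat_pow_def Diff_circle_def rotation_0 rotation_add algebra_simps)

lemma SO2_tor_eq: "SO2_tor = range (\<lambda>q::rat. rotation (of_rat q))"
proof (intro equalityI subsetI)
  fix r
  assume "r \<in> SO2_tor"
  then obtain a n where r: "r = rotation a" "n > 0" "rotation a [^]\<^bsub>Diff_circle\<^esub> (n::nat) = \<one>\<^bsub>Diff_circle\<^esub>"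
    by (auto simp: SO2_tor_def SO2_def)
  then have "rotation (of_nat n * a) = rotation 0"
    by (simp add: rotation_power rotation_0) (simp add: Diff_circle_def)
  then obtain m where "of_nat n * a = of_int m" by (auto simp: rotation_eq_iff Ints_def)
  with r(2) have "a = of_rat (of_int m / of_nat n)"
    by (simp add: of_rat_divide field_simps)
  with r(1) show "r \<in> range (\<lambda>q::rat. rotation (of_rat q))" by blast
next
  fix r
  assume "r \<in> range (\<lambda>q::rat. rotation (of_rat q))"
  then obtain q :: rat where r: "r = rotation (of_rat q)" by blast
  obtain a d where ad: "q = of_int a / of_int d" "d > 0"
    using quotient_of_div[of q] quotient_of_denom_pos'[of q] by (metis prod.collapse)
  then have "of_nat (nat d) * of_rat q = (of_int a :: real)" by (simp add: of_rat_divide)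
  then have "rotation (of_rat q) [^]\<^bsub>Diff_circle\<^esub> nat d = \<one>\<^bsub>Diff_circle\<^esub>"
    unfolding rotation_power by (simp add: Diff_circle_def rotation_eq_iff flip: rotation_0)
  with ad(2) show "r \<in> SO2_tor"
    unfolding SO2_tor_def SO2_def r by (auto intro!: exI[of _ "nat d"])
qed

text \<open>Read off at 0 because the chosen lift of a rational rotation is a translation by a
  rational number. This number need not lie in [0,1).\<close>

definition rotation_number :: "(circle \<Rightarrow> circle) \<Rightarrow> rat" where
  "rotation_number r = (THE q. of_rat q = circle_section r 0)"

lemma circle_section_rotation:
  assumes "r \<in> SO2_tor" "r \<in> carrier Diff_circle"
  shows "circle_section r x = x + of_rat (rotation_number r)"
    and "rotation (of_rat (rotation_number r)) = r"
proof -
  obtain q :: rat where q: "r = rotation (of_rat q)" using assms(1) SO2_tor_eq by auto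
  obtain m where m: "\<And>x. circle_section r x = x + of_rat q + of_int m"
    by (rule lifts_differ_by_Ints[of "circle_section r" "\<lambda>x. x + of_rat q"])
       (use assms in \<open>auto simp: circle_section q intro!: continuous_intros\<close>)
  have "rotation_number r = q + of_int m"
    unfolding rotation_number_def
  proof (rule the_equality)
    show 0: "of_rat (q + of_int m) = circle_section r 0" by (simp add: m of_rat_add)
    show "q' = q + of_int m" if "of_rat q' = circle_section r 0" for q'
      using that unfolding 0[symmetric] by simp
  qed
  then show "circle_section r x = x + of_rat (rotation_number r)"
    "rotation (of_rat (rotation_number r)) = r"
    using m by (simp_all add: of_rat_add q rotation_eq_iff)
qed

text \<open>The cocycle identity compares two bracketings of three lifts. On rational rotations the
  lifts are translations, so the cocycle is the defect of additivity of the rotation number.\<close>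

lemma circle_extension:
  assumes "subgroup \<Gamma> Diff_circle" "SO2 \<subseteq> \<Gamma>"
  shows "circle_extension (Diff_circle\<lparr>carrier := \<Gamma>\<rparr>) euler_cocycle SO2_tor
    (\<lambda>q. rotation (of_rat q)) rotation_number"
proof -
  interpret subgroup \<Gamma> Diff_circle by fact
  have mult: "f \<otimes>\<^bsub>Diff_circle\<^esub> g = f \<circ> g" and one: "\<one>\<^bsub>Diff_circle\<^esub> = id" for f g
    by (simp_all add: Diff_circle_def)
  have D: "f \<in> carrier Diff_circle" if "f \<in> \<Gamma>" for f using subset that by blast
  have closed: "f \<circ> g \<in> \<Gamma>" if "f \<in> \<Gamma>" "g \<in> \<Gamma>" for f g
    using m_closed[OF that] by (simp add: mult)
  have tor: "SO2_tor \<subseteq> \<Gamma>" using assms(2) by (auto simp: SO2_tor_def)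
  have euler: "circle_section f (circle_section g x) = circle_section (f \<circ> g) x + of_int (euler_cocycle f g)"
    if "f \<in> \<Gamma>" "g \<in> \<Gamma>" for f g x
    using euler_cocycle D closed that by blast
  have tor_closed: "f \<circ> g \<in> SO2_tor" if "f \<in> SO2_tor" "g \<in> SO2_tor" for f g
    using that unfolding SO2_tor_eq by (auto simp: rotation_add simp flip: of_rat_add)
  have id_tor: "id \<in> SO2_tor"
    unfolding SO2_tor_eq by (rule image_eqI[of _ _ 0]) (simp_all add: rotation_0)
  have "two_cocycle (Diff_circle\<lparr>carrier := \<Gamma>\<rparr>) euler_cocycle"
  proof
    fix f g h
    assume "f \<in> carrier (Diff_circle\<lparr>carrier := \<Gamma>\<rparr>)" "g \<in> carrier (Diff_circle\<lparr>carrier := \<Gamma>\<rparr>)"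
      "h \<in> carrier (Diff_circle\<lparr>carrier := \<Gamma>\<rparr>)"
    then have mem: "f \<in> \<Gamma>" "g \<in> \<Gamma>" "h \<in> \<Gamma>" by simp_all
    let ?s = circle_section and ?c = euler_cocycle
    have "?s f (?s g (?s h 0)) = ?s (f \<circ> g \<circ> h) 0 + of_int (?c f g) + of_int (?c (f \<circ> g) h)"
      unfolding euler[OF mem(1,2)] using euler[of "f \<circ> g" h 0] mem closed by simp
    \<comment> \<open>Centrality enters here: the lift of \<open>f\<close> commutes with integer
      translations, so the inner integer can be moved outside.\<close>
    moreover have "?s f (?s g (?s h 0)) = ?s (f \<circ> (g \<circ> h)) 0 + of_int (?c g h) + of_int (?c f (g \<circ> h))"
      using euler mem closed circle_section(2) D by simp
    ultimately have "(of_int (?c g h + ?c f (g \<circ> h)) :: real) = of_int (?c (f \<circ> g) h + ?c f g)"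
      by (simp add: comp_assoc)
    then have "?c g h + ?c f (g \<circ> h) = ?c (f \<circ> g) h + ?c f g"
      by (simp only: of_int_eq_iff)
    then show "?c g h + ?c f (g \<otimes>\<^bsub>Diff_circle\<lparr>carrier := \<Gamma>\<rparr>\<^esub> h)
        = ?c (f \<otimes>\<^bsub>Diff_circle\<lparr>carrier := \<Gamma>\<rparr>\<^esub> g) h + ?c f g"
      by (simp add: mult)
  qed (use closed one_closed in \<open>auto simp: mult one comp_assoc\<close>)
  moreover have "rational_circle (Diff_circle\<lparr>carrier := SO2_tor\<rparr>) (\<lambda>q. rotation (of_rat q))
      rotation_number euler_cocycle"
  proof
    fix f g
    assume "f \<in> carrier (Diff_circle\<lparr>carrier := SO2_tor\<rparr>)" "g \<in> carrier (Diff_circle\<lparr>carrier := SO2_tor\<rparr>)"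
    then have fg: "f \<in> SO2_tor" "g \<in> SO2_tor" by simp_all
    have s: "circle_section r x = x + of_rat (rotation_number r)" if "r \<in> SO2_tor" for r x
      using circle_section_rotation(1)[OF that] D tor that by blast
    have "(of_rat (of_int (euler_cocycle f g)) :: real)
        = of_rat (rotation_number f + rotation_number g - rotation_number (f \<circ> g))"
      using euler[of f g 0] fg tor s tor_closed[OF fg] by (simp add: of_rat_add of_rat_diff subset_iff)
    then show "of_int (euler_cocycle f g) = rotation_number f + rotation_number g
        - rotation_number (f \<otimes>\<^bsub>Diff_circle\<lparr>carrier := SO2_tor\<rparr>\<^esub> g)"
      by (simp only: of_rat_eq_iff mult monoid.simps) (simp add: mult)
  next
    fix x y :: rat
    have "(of_rat x - of_rat y :: real) \<in> \<int> \<longleftrightarrow> x - y \<in> \<int>"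
      by (metis Ints_cases Ints_of_int of_rat_diff of_rat_eq_iff of_rat_of_int_eq)
    then show "rotation (of_rat x) = rotation (of_rat y) \<longleftrightarrow> x - y \<in> \<int>"
      by (simp add: rotation_eq_iff)
  next
    fix g
    assume "g \<in> carrier (Diff_circle\<lparr>carrier := SO2_tor\<rparr>)"
    then show "rotation (of_rat (rotation_number g)) = g"
      using circle_section_rotation(2)[of g] D tor by auto
  qed (use tor_closed id_tor in \<open>auto simp: mult one comp_assoc SO2_tor_eq rotation_add of_rat_add\<close>)
  ultimately show ?thesis
    using tor by (simp add: circle_extension_def circle_extension_axioms_def)
qed

definition euler_cochain :: "(circle \<Rightarrow> circle) set \<Rightarrow> (circle \<Rightarrow> circle) list \<Rightarrow> rat" where
  "euler_cochain \<Gamma> xs = (if xs \<in> tuples 2 (Diff_circle\<lparr>carrier := \<Gamma>\<rparr>)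
     then of_int (extension_cocycle Diff_line_periodic translation Diff_circle circle_section xs) else 0)"

lemma euler_cochain_in_euler_class_on: "euler_cochain \<Gamma> \<in> euler_class_on \<Gamma>"
proof -
  let ?f = "\<lambda>xs. of_int (extension_cocycle Diff_line_periodic translation Diff_circle circle_section xs) :: rat"
  have "?f \<in> euler_class"
    unfolding euler_class_def rational_extension_class_def circle_section_def[symmetric]
    by (rule cohomology_class_self)
  moreover have "euler_cochain \<Gamma> \<in> cohomology_class 2 (Diff_circle\<lparr>carrier := \<Gamma>\<rparr>)
      (\<lambda>xs. if xs \<in> tuples 2 (Diff_circle\<lparr>carrier := \<Gamma>\<rparr>) then ?f (map id xs) else 0)"
    using cohomology_class_self[of "euler_cochain \<Gamma>" 2 "Diff_circle\<lparr>carrier := \<Gamma>\<rparr>"]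
    by (simp add: euler_cochain_def[abs_def] cong: if_cong)
  ultimately show ?thesis
    unfolding euler_class_on_def cohomology_map_def by blast
qed

theorem theorem1p13:
  fixes \<Gamma> :: "(circle \<Rightarrow> circle) set" and k :: nat
  assumes "subgroup \<Gamma> Diff_circle" and "SO2 \<subseteq> \<Gamma>" and "k \<ge> 1"
  shows "(\<forall>l\<ge>1. H_sub SO2_tor (2 * l - 1) \<cong> rat_mod_int)
    \<and> (incl_injective \<Gamma> (2 * k - 1) \<longrightarrow> (\<forall>l\<ge>k. incl_injective \<Gamma> (2 * l - 1)))
    \<and> (incl_nontrivial \<Gamma> (2 * k - 1) \<longrightarrow> (\<forall>l\<ge>k. incl_nontrivial \<Gamma> (2 * l - 1)))
    \<and> (cup_power (Diff_circle\<lparr>carrier := \<Gamma>\<rparr>) 2 (euler_class_on \<Gamma>) k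
          = \<one>\<^bsub>group_cohomology (2 * k) (Diff_circle\<lparr>carrier := \<Gamma>\<rparr>)\<^esub>
        \<longrightarrow> (\<forall>l\<ge>k. incl_injective \<Gamma> (2 * l - 1)))"
proof -
  interpret E: circle_extension "Diff_circle\<lparr>carrier := \<Gamma>\<rparr>" euler_cocycle SO2_tor
    "\<lambda>q. rotation (of_rat q)" rotation_number
    by (rule circle_extension[OF assms(1,2)])
  let ?G = "Diff_circle\<lparr>carrier := \<Gamma>\<rparr>" and ?C = "Diff_circle\<lparr>carrier := SO2_tor\<rparr>"
  have iso: "H_sub SO2_tor (2 * l - 1) \<cong> rat_mod_int" if l: "l \<ge> 1" for l
  proof -
    obtain j where "l = Suc j" using l by (cases l) auto
    then show ?thesis using E.C.group_homology_iso[of j] by simp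
  qed
  have inj: "incl_injective \<Gamma> n \<longleftrightarrow> bar_cycles n ?C \<inter> bar_boundaries n ?G \<subseteq> bar_boundaries n ?C" for n
    using homology_map_inj_iff[OF E.sub, of n] by (simp add: incl_injective_def)
  have nontriv: "incl_nontrivial \<Gamma> n \<longleftrightarrow> \<not> bar_cycles n ?C \<subseteq> bar_boundaries n ?G" for n
    using homology_map_nontrivial_iff[OF E.sub, of n] by (simp add: incl_nontrivial_def)
  \<comment> \<open>Raising \<open>l\<close> by one raises the degree by two. Since \<open>k\<close>
    is positive, every \<open>l\<close> has the form \<open>Suc j\<close>, so
    \<open>2 * l - 1\<close> is the odd number 2j+1 despite truncated subtraction.\<close>
  have up: "P (2 * l - 1)" if "P (2 * k - 1)" "\<And>m. P (Suc m) \<Longrightarrow> P (Suc (Suc (Suc m)))" "l \<ge> k"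
    for P :: "nat \<Rightarrow> bool" and l
    using that(3)
  proof (induction l rule: dec_induct)
    case (step l)
    then obtain j where "l = Suc j" using assms(3) by (metis Suc_le_D One_nat_def le_trans)
    then show ?case using step.IH that(2)[of "2 * j"] by simp
  qed (rule that(1))
  have inj_up: "incl_injective \<Gamma> (2 * l - 1)" if "incl_injective \<Gamma> (2 * k - 1)" "l \<ge> k" for l
    by (rule up[of "incl_injective \<Gamma>", OF that(1) _ that(2)]) (use E.injective_step in \<open>simp add: inj\<close>)
  have nontriv_up: "incl_nontrivial \<Gamma> (2 * l - 1)" if "incl_nontrivial \<Gamma> (2 * k - 1)" "l \<ge> k" for l
    by (rule up[of "incl_nontrivial \<Gamma>", OF that(1) _ that(2)]) (use E.nontrivial_step in \<open>simp add: nontriv\<close>)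
  have "incl_injective \<Gamma> (2 * k - 1)"
    if "cup_power ?G 2 (euler_class_on \<Gamma>) k = \<one>\<^bsub>group_cohomology (2 * k) ?G\<^esub>"
  proof -
    obtain j where j: "k = Suc j" using assms(3) by (cases k) auto
    have "euler_cochain \<Gamma> [f, g] = of_int (euler_cocycle f g)"
      if "f \<in> carrier ?G" "g \<in> carrier ?G" for f g
      using that by (simp add: euler_cochain_def euler_cocycle_def tuples_def)
    from E.injective_if_power_trivial[OF this euler_cochain_in_euler_class_on, of j] that
    show ?thesis by (simp add: inj j)
  qed
  with iso inj_up nontriv_up show ?thesis by blast
qed

end
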